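(* Let $B\subset\mathbb{R}^3$ be a convex body of constant width $2w$ (with $w>0$) which is a local minimizer of the Blaschke-Lebesgue problem in $\mathbb{R}^3$. Then on every smooth part of the boundary $\partial B$ the smaller principal curvature is constant and equal to $\frac{1}{2w}$.
   Context: A convex body in $\mathbb{R}^3$ is a compact convex set with nonempty interior. Its width in the direction $u\in\mathbb{S}^2$ is the distance between its two supporting planes orthogonal to $u$; $B$ has constant width $2w$ if this distance equals $2w$ for every $u$. For a convex body $B$ of constant width $2w$ set $\mathcal{I}(B)=\mathcal{V}(B)/(4\pi w^3/3)$, the ratio of the volume $\mathcal{V}(B)$ of $B$ to the volume of the ball of the same width. The Blaschke-Lebesgue problem is the problem of minimizing $\mathcal{I}$ among all convex bodies of constant width; $B$ is a local minimizer if there is $\delta>0$ such that $\mathcal{I}(B)\le\mathcal{I}(B')$ for every convex body $B'$ of constant width (of any width) whose Hausdorff distance to $B$ is less than $\delta$. A smooth part of $\partial B$ is a connected, relatively open subset of $\partial B$ which is an embedded surface of class $C^2$ ("smooth" means twice continuously differentiable). Principal curvatures are taken with the sign convention for which a sphere of radius $r$ has both principal curvatures equal to $1/r$ (i.e. they are the eigenvalues of the differential of the outward unit normal map). *)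

theory Defs
  imports "HOL-Analysis.Analysis"
begin

section \<open>Convex bodies and constant width\<close>

definition convex_body :: "'a::euclidean_space set \<Rightarrow> bool" where
  "convex_body K \<longleftrightarrow> compact K \<and> convex K \<and> interior K \<noteq> {}"

definition supporting_plane :: "'a::euclidean_space set \<Rightarrow> 'a \<Rightarrow> 'a set" where
  "supporting_plane K u = {x. u \<bullet> x = (SUP y\<in>K. u \<bullet> y)}"

definition body_width :: "'a::euclidean_space set \<Rightarrow> 'a \<Rightarrow> real" where
  "body_width K u = setdist (supporting_plane K u) (supporting_plane K (- u))"

definition has_constant_width :: "'a::euclidean_space set \<Rightarrow> real \<Rightarrow> bool" where
  "has_constant_width K d \<longleftrightarrow> (\<forall>u. norm u = 1 \<longrightarrow> body_width K u = d)"

section \<open>The Blaschke-Lebesgue problem\<close>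

text \<open>The value is meaningful for a body of constant width \<open>2 * w\<close>; the half-width is
  passed explicitly instead of being recovered from the body.\<close>

definition volume_ratio :: "real \<Rightarrow> (real^3) set \<Rightarrow> real" where
  "volume_ratio w K = measure lebesgue K / (4 * pi * w ^ 3 / 3)"

text \<open>Used only for nonempty compact sets, where both suprema are over bounded sets.\<close>

definition hausdorff_distance :: "'a::metric_space set \<Rightarrow> 'a set \<Rightarrow> real" where
  "hausdorff_distance A B = max (SUP a\<in>A. infdist a B) (SUP b\<in>B. infdist b A)"

definition local_minimizer :: "real \<Rightarrow> (real^3) set \<Rightarrow> bool" where
  "local_minimizer w B \<longleftrightarrow>
     convex_body B \<and> w > 0 \<and> has_constant_width B (2 * w) \<and>
     (\<exists>\<delta>>0. \<forall>B' w'. convex_body B' \<and> w' > 0 \<and> has_constant_width B' (2 * w') \<and>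
        hausdorff_distance B B' < \<delta> \<longrightarrow> volume_ratio w B \<le> volume_ratio w' B')"

section \<open>Smooth parts of the boundary\<close>

definition C2_on :: "('a::real_normed_vector \<Rightarrow> 'b::real_normed_vector) \<Rightarrow> 'a set \<Rightarrow> bool" where
  "C2_on f U \<longleftrightarrow>
     (\<exists>(f' :: 'a \<Rightarrow> 'a \<Rightarrow>\<^sub>L 'b) (f'' :: 'a \<Rightarrow> 'a \<Rightarrow>\<^sub>L ('a \<Rightarrow>\<^sub>L 'b)).
        (\<forall>x\<in>U. (f has_derivative blinfun_apply (f' x)) (at x)) \<and>
        (\<forall>x\<in>U. (f' has_derivative blinfun_apply (f'' x)) (at x)) \<and>
        continuous_on U f'')"

definition embedded_C2_surface :: "(real^3) set \<Rightarrow> bool" where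
  "embedded_C2_surface S \<longleftrightarrow>
     (\<forall>p\<in>S. \<exists>V U (\<phi> :: real^2 \<Rightarrow> real^3) \<psi>.
        open V \<and> p \<in> V \<and> open U \<and> C2_on \<phi> U \<and>
        (\<forall>x\<in>U. inj (frechet_derivative \<phi> (at x))) \<and>
        homeomorphism U (S \<inter> V) \<phi> \<psi>)"

definition smooth_part :: "(real^3) set \<Rightarrow> (real^3) set \<Rightarrow> bool" where
  "smooth_part B S \<longleftrightarrow>
     openin (top_of_set (frontier B)) S \<and> connected S \<and> embedded_C2_surface S"

section \<open>Principal curvatures\<close>

definition tangent_plane :: "(real^3) set \<Rightarrow> real^3 \<Rightarrow> (real^3) set" where
  "tangent_plane S p =
     {v. \<exists>\<epsilon>>0. \<exists>c :: real \<Rightarrow> real^3.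
        (\<forall>t\<in>{-\<epsilon><..<\<epsilon>}. c t \<in> S \<and> c differentiable (at t)) \<and>
        c 0 = p \<and> (c has_vector_derivative v) (at 0)}"

text \<open>A normal \<open>n\<close> of the surface at \<open>p\<close> points out of the convex body \<open>B\<close> if
  \<open>B\<close> lies in the half-space behind the tangent plane.\<close>

definition outward_unit_normal :: "(real^3) set \<Rightarrow> (real^3) set \<Rightarrow> real^3 \<Rightarrow> real^3" where
  "outward_unit_normal B S p =
     (THE n. norm n = 1 \<and> (\<forall>v\<in>tangent_plane S p. n \<bullet> v = 0) \<and>
        (\<forall>x\<in>B. n \<bullet> (x - p) \<le> 0))"

text \<open>A derivative within \<open>S\<close> is determined only on the tangent plane, where it is the
  differential of the normal map; eigenvectors are therefore required to be tangent.
  With this sign a sphere of radius \<open>r\<close> has curvatures \<open>1 / r\<close>.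
  Multiplicities are not recorded.\<close>

definition principal_curvatures :: "(real^3) set \<Rightarrow> (real^3) set \<Rightarrow> real^3 \<Rightarrow> real set" where
  "principal_curvatures B S p =
     {\<kappa>. \<exists>L. (outward_unit_normal B S has_derivative L) (at p within S) \<and>
        (\<exists>v\<in>tangent_plane S p. v \<noteq> 0 \<and> L v = \<kappa> *\<^sub>R v)}"

definition smaller_principal_curvature :: "(real^3) set \<Rightarrow> (real^3) set \<Rightarrow> real^3 \<Rightarrow> real" where
  "smaller_principal_curvature B S p = Min (principal_curvatures B S p)"

end

theory Submission
  imports Defs
begin

text \<open>Let \<open>p\<close> be a point of the smooth part with outward normal \<open>a\<close>, and suppose that \<open>1/(2w)\<close> is not a
  principal curvature at \<open>p\<close>.  Then the patch around \<open>p\<close> and the opposite patch, traced by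
  \<open>q - 2w N(q)\<close>, both have normals that depend in a Lipschitz way on the point, so that small balls of
  a fixed radius roll inside \<open>B\<close> near both of them.  Hence adding \<open>\<plusminus>\<epsilon>\<close> times an odd bump supported near
  \<open>\<plusminus>a\<close> to the support function gives two bodies \<open>K\<close>, \<open>L\<close> of the same constant width with
  \<open>(K + L)/2 \<subseteq> B\<close>.  Their shadows along \<open>a\<close> agree, so averaging \<open>K\<close> and \<open>L\<close> on each line parallel to
  \<open>a\<close> gives, by Fubini, a compact subset of \<open>B\<close> of volume \<open>(V(K) + V(L))/2\<close>, and this subset
  misses some boundary points of \<open>B\<close>.  So one of \<open>K\<close>, \<open>L\<close> has smaller volume than \<open>B\<close>.  No principal curvature is
  below \<open>1/(2w)\<close>, because \<open>B\<close> lies in the ball of radius \<open>2w\<close> around \<open>q - 2w N(q)\<close>.\<close>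

section \<open>Support functions\<close>

text \<open>Constant width says that the support values at \<open>u\<close> and \<open>- u\<close>
  add up to \<open>2 * w\<close>, so only odd perturbations keep the width; the ratios to compare
  then have equal denominators. The obstacle is that a support function plus a small function need
  not be a support function. A ball of fixed radius touching from inside absorbs the error, and
  oddness demands such balls at two opposite patches at once. On tangent vectors the map
  \<open>q - 2w N(q)\<close> has derivative \<open>id - 2w dN\<close>, which is injective exactly
  when \<open>1/(2w)\<close> is not a principal curvature; this is how the curvature enters. A ball
  lies inside only if the normals are controlled against all boundary points, not just nearby ones.
  Passing from local to global takes compactness and the exclusion of circular arcs of radius
  \<open>2w\<close>. Volume is never differentiated: the length of an average of two intervals is
  exactly the mean length. Strictness comes from an oblique direction \<open>u\<close>, for which
  the support points of the two perturbed bodies differ by a vector not parallel to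
  \<open>a\<close>.\<close>

definition support_fun :: "'a::euclidean_space set \<Rightarrow> 'a \<Rightarrow> real" where
  "support_fun K u = (SUP y\<in>K. u \<bullet> y)"

definition supports :: "'a::euclidean_space set \<Rightarrow> 'a \<Rightarrow> 'a \<Rightarrow> bool" where
  "supports K u x \<longleftrightarrow> x \<in> K \<and> u \<bullet> x = support_fun K u"

lemma inner_le_support_fun:
  fixes K :: "'a::euclidean_space set"
  assumes "compact K" "x \<in> K"
  shows "u \<bullet> x \<le> support_fun K u"
  unfolding support_fun_def
proof (rule cSUP_upper)
  have "compact ((\<lambda>y. u \<bullet> y) ` K)"
    by (intro compact_continuous_image continuous_intros assms)
  then show "bdd_above ((\<lambda>y. u \<bullet> y) ` K)"
    by (simp add: bounded_imp_bdd_above compact_imp_bounded)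
qed (use assms in auto)

lemma supports_exists:
  fixes K :: "'a::euclidean_space set"
  assumes "compact K" "K \<noteq> {}"
  obtains x where "supports K u x"
proof -
  have "continuous_on K (\<lambda>y. u \<bullet> y)"
    by (intro continuous_intros)
  then obtain x where x: "x \<in> K" "\<forall>y\<in>K. u \<bullet> y \<le> u \<bullet> x"
    using continuous_attains_sup[OF assms] by blast
  then have "support_fun K u \<le> u \<bullet> x"
    unfolding support_fun_def using assms by (intro cSUP_least) auto
  with inner_le_support_fun[OF assms(1) x(1), of u] x have "supports K u x"
    by (simp add: supports_def)
  then show ?thesis ..
qed

lemma supportsI:
  fixes K :: "'a::euclidean_space set"
  assumes "compact K" "x \<in> K" "\<And>y. y \<in> K \<Longrightarrow> u \<bullet> y \<le> u \<bullet> x"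
  shows "supports K u x"
proof -
  obtain z where "supports K u z"
    using supports_exists assms(1,2) by blast
  then show ?thesis
    using assms inner_le_support_fun[OF assms(1,2), of u] unfolding supports_def by force
qed

lemma support_fun_eqI:
  fixes K :: "'a::euclidean_space set"
  assumes "x \<in> K" "u \<bullet> x = c" "\<And>y. y \<in> K \<Longrightarrow> u \<bullet> y \<le> c"
  shows "support_fun K u = c"
  unfolding support_fun_def using assms by (intro cSup_eq_maximum) auto


lemma mem_of_support_fun:
  fixes K :: "'a::euclidean_space set"
  assumes "compact K" "convex K" "K \<noteq> {}"
    and le: "\<And>v. norm v = 1 \<Longrightarrow> v \<bullet> x \<le> support_fun K v"
  shows "x \<in> K"
proof (rule ccontr)
  assume "x \<notin> K"
  then obtain a b where ab: "a \<bullet> x < b" "\<forall>y\<in>K. a \<bullet> y > b"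
    using separating_hyperplane_closed_point assms(1,2) compact_imp_closed by metis
  then have "a \<noteq> 0"
    using assms(3) by force
  define v where "v = (- 1 / norm a) *\<^sub>R a"
  have v: "norm v = 1"
    using \<open>a \<noteq> 0\<close> by (simp add: v_def)
  obtain y where y: "supports K v y"
    using supports_exists assms by blast
  then have "v \<bullet> x \<le> v \<bullet> y"
    using le[OF v] by (simp add: supports_def)
  then have "a \<bullet> y \<le> a \<bullet> x"
    using \<open>a \<noteq> 0\<close> by (simp add: v_def divide_simps)
  then show False
    using ab y by (force simp: supports_def)
qed

lemma setdist_parallel_planes:
  fixes u :: "'a::euclidean_space"
  assumes "norm u = 1" "\<alpha> + \<beta> \<ge> 0"
  shows "setdist {x. u \<bullet> x = \<alpha>} {x. (- u) \<bullet> x = \<beta>} = \<alpha> + \<beta>"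
proof (rule antisym)
  have uu: "u \<bullet> u = 1"
    using assms by (simp add: norm_eq_1)
  have "setdist {x. u \<bullet> x = \<alpha>} {x. (- u) \<bullet> x = \<beta>} \<le> dist (\<alpha> *\<^sub>R u) ((- \<beta>) *\<^sub>R u)"
    by (rule setdist_le_dist) (auto simp: uu)
  also have "\<dots> = \<alpha> + \<beta>"
    using assms by (simp add: dist_norm flip: scaleR_add_left)
  finally show "setdist {x. u \<bullet> x = \<alpha>} {x. (- u) \<bullet> x = \<beta>} \<le> \<alpha> + \<beta>" .
  have ne: "\<alpha> *\<^sub>R u \<in> {x. u \<bullet> x = \<alpha>}" "(- \<beta>) *\<^sub>R u \<in> {x. (- u) \<bullet> x = \<beta>}"
    by (auto simp: uu)
  show "\<alpha> + \<beta> \<le> setdist {x. u \<bullet> x = \<alpha>} {x. (- u) \<bullet> x = \<beta>}"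
  proof (rule le_setdistI)
    fix x y assume "x \<in> {x. u \<bullet> x = \<alpha>}" "y \<in> {x. (- u) \<bullet> x = \<beta>}"
    then have "\<alpha> + \<beta> = u \<bullet> (x - y)"
      by (simp add: inner_diff_right)
    also have "\<dots> \<le> norm u * norm (x - y)"
      by (rule norm_cauchy_schwarz)
    finally show "\<alpha> + \<beta> \<le> dist x y"
      using assms by (simp add: dist_norm)
  qed (use ne in blast)+
qed

lemma body_width_eq_support_fun:
  fixes K :: "'a::euclidean_space set"
  assumes "compact K" "K \<noteq> {}" "norm u = 1"
  shows "body_width K u = support_fun K u + support_fun K (- u)"
proof -
  obtain y where y: "y \<in> K"
    using assms by auto
  have "support_fun K u + support_fun K (- u) \<ge> 0"
    using inner_le_support_fun[OF assms(1) y, of u] inner_le_support_fun[OF assms(1) y, of "- u"]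
    by simp
  from setdist_parallel_planes[OF assms(3) this] show ?thesis
    by (simp add: body_width_def supporting_plane_def support_fun_def)
qed

text \<open>At the point \<open>b\<close> of \<open>B\<close> nearest to \<open>a\<close>, the unit
  vector \<open>v\<close> from \<open>b\<close> to \<open>a\<close> is an outer normal of
  \<open>B\<close>. Hence the distance is \<open>v \<bullet> a - support_fun B v\<close>, which is
  at most the difference of the support values at \<open>v\<close>.\<close>

lemma infdist_le_of_support_fun_le:
  fixes A B :: "'a::euclidean_space set"
  assumes A: "compact A" and B: "compact B" "convex B" "B \<noteq> {}" and e: "e \<ge> 0"
    and le: "\<And>v. norm v = 1 \<Longrightarrow> support_fun A v \<le> support_fun B v + e" and a: "a \<in> A"
  shows "infdist a B \<le> e"
proof (cases "a \<in> B")
  case True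
  then show ?thesis using e by simp
next
  case False
  define b where "b = closest_point B a"
  define v where "v = sgn (a - b)"
  have clB: "closed B"
    using B by (simp add: compact_imp_closed)
  have b: "b \<in> B"
    unfolding b_def using clB B(3) by (rule closest_point_in_set)
  then have "a - b \<noteq> 0"
    using False by auto
  then have v: "norm v = 1"
    by (simp add: v_def norm_sgn)
  have "(a - b) \<bullet> (y - b) \<le> 0" if "y \<in> B" for y
    unfolding b_def by (rule closest_point_dot[OF B(2) clB that])
  then have "v \<bullet> (y - b) \<le> 0" if "y \<in> B" for y
    using that \<open>a - b \<noteq> 0\<close> by (simp add: v_def sgn_div_norm mult_nonneg_nonpos divide_nonpos_nonneg)
  then have "supports B v b"
    by (intro supportsI B b) (simp add: inner_diff_right)
  then have "v \<bullet> a \<le> v \<bullet> b + e"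
    using inner_le_support_fun[OF A a, of v] le[OF v] by (simp add: supports_def)
  moreover have "v \<bullet> (a - b) = norm (a - b)"
    using \<open>a - b \<noteq> 0\<close> by (simp add: v_def sgn_div_norm power2_norm_eq_inner[symmetric] power2_eq_square)
  ultimately have "dist a b \<le> e"
    by (simp add: dist_norm inner_diff_right)
  then show ?thesis
    using infdist_le[OF b, of a] by simp
qed

lemma hausdorff_distance_le_of_support_fun:
  fixes A B :: "'a::euclidean_space set"
  assumes "compact A" "convex A" "A \<noteq> {}" "compact B" "convex B" "B \<noteq> {}" "e \<ge> 0"
    and "\<And>v. norm v = 1 \<Longrightarrow> \<bar>support_fun A v - support_fun B v\<bar> \<le> e"
  shows "hausdorff_distance A B \<le> e"
proof -
  have *: "support_fun A v \<le> support_fun B v + e" "support_fun B v \<le> support_fun A v + e"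
    if "norm v = 1" for v
    using assms(8)[OF that] by linarith+
  have "infdist a B \<le> e" if "a \<in> A" for a
    using assms that * by (intro infdist_le_of_support_fun_le[of A B e]) auto
  moreover have "infdist b A \<le> e" if "b \<in> B" for b
    using assms that * by (intro infdist_le_of_support_fun_le[of B A e]) auto
  ultimately show ?thesis
    unfolding hausdorff_distance_def using assms by (auto intro!: cSUP_least)
qed

section \<open>Bodies of constant width\<close>

locale constant_width_body =
  fixes K :: "'a::euclidean_space set" and w :: real
  assumes w_pos: "w > 0" and body: "convex_body K" and width: "has_constant_width K (2 * w)"
begin

lemma compact_body: "compact K" and convex_body: "convex K" and interior_body: "interior K \<noteq> {}"
  and nonempty_body: "K \<noteq> {}"
  using body unfolding convex_body_def by auto

lemma support_fun_minus:
  assumes "norm u = 1"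
  shows "support_fun K (- u) = 2 * w - support_fun K u"
  using width assms body_width_eq_support_fun[OF compact_body nonempty_body assms]
  by (simp add: has_constant_width_def)

lemma diameter_le:
  assumes "x \<in> K" "y \<in> K"
  shows "norm (x - y) \<le> 2 * w"
proof (cases "x = y")
  case True
  then show ?thesis using w_pos by simp
next
  case False
  define e where "e = sgn (x - y)"
  have e: "norm e = 1"
    using False by (simp add: e_def norm_sgn)
  have "norm (x - y) = e \<bullet> (x - y)"
    using False by (simp add: e_def sgn_div_norm power2_norm_eq_inner[symmetric] power2_eq_square)
  also have "\<dots> \<le> support_fun K e + support_fun K (- e)"
    using inner_le_support_fun[OF compact_body assms(1), of e]
      inner_le_support_fun[OF compact_body assms(2), of "- e"] by (simp add: inner_diff_right)
  finally show ?thesis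
    using support_fun_minus[OF e] by simp
qed

text \<open>A support point \<open>y\<close> for \<open>- u\<close> satisfies
  \<open>u \<bullet> (x - y) = 2 * w\<close>, while the diameter bound gives
  \<open>norm (x - y) \<le> 2 * w\<close>. Equality in Cauchy-Schwarz forces \<open>x - y\<close> to
  be \<open>2w u\<close>, so chords between opposite support points are normal at both ends.\<close>

lemma supports_opposite:
  assumes "norm u = 1" "supports K u x"
  shows "supports K (- u) (x - (2 * w) *\<^sub>R u)"
proof -
  obtain y where y: "supports K (- u) y"
    using supports_exists compact_body nonempty_body by blast
  have uu: "u \<bullet> u = 1"
    using assms by (simp add: norm_eq_1)
  have eq: "u \<bullet> (x - y) = 2 * w"
    using y assms support_fun_minus[OF assms(1)] by (simp add: supports_def inner_diff_right)
  have "norm (x - y) \<le> 2 * w"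
    using y assms by (intro diameter_le) (auto simp: supports_def)
  then have "(norm (x - y))\<^sup>2 \<le> (2 * w)\<^sup>2"
    by (intro power_mono) auto
  moreover have "(norm (x - y - (2 * w) *\<^sub>R u))\<^sup>2 = (norm (x - y))\<^sup>2 - 2 * (2 * w) * (u \<bullet> (x - y)) + (2 * w)\<^sup>2"
    unfolding power2_norm_eq_inner using uu
    by (simp add: inner_diff_left inner_diff_right inner_commute algebra_simps power2_eq_square)
  ultimately have "(norm (x - y - (2 * w) *\<^sub>R u))\<^sup>2 \<le> 0"
    unfolding eq by (simp add: power2_eq_square)
  then have "y = x - (2 * w) *\<^sub>R u"
    by (simp add: algebra_simps)
  then show ?thesis using y by simp
qed

text \<open>By the diameter bound the body lies in the ball of radius \<open>2w\<close> around the
  opposite point \<open>x - 2w u\<close>; the inequality is that inclusion with the square expanded.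
  It converts a distance between boundary points into depth below a supporting plane.\<close>

lemma exterior_ball:
  assumes u: "norm u = 1" and "supports K u x" and "y \<in> K"
  shows "(norm (y - x))\<^sup>2 \<le> 4 * w * (u \<bullet> (x - y))"
proof -
  have uu: "u \<bullet> u = 1"
    using assms by (simp add: norm_eq_1)
  have "norm (y - (x - (2 * w) *\<^sub>R u)) \<le> 2 * w"
    using supports_opposite[OF assms(1,2)] assms(3) by (intro diameter_le) (auto simp: supports_def)
  then have "(norm (y - (x - (2 * w) *\<^sub>R u)))\<^sup>2 \<le> (2 * w)\<^sup>2"
    by (intro power_mono) auto
  moreover have "(norm (y - (x - (2 * w) *\<^sub>R u)))\<^sup>2 = (norm (y - x))\<^sup>2 - 4 * w * (u \<bullet> (x - y)) + (2 * w)\<^sup>2"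
    unfolding power2_norm_eq_inner using uu
    by (simp add: inner_diff_left inner_diff_right inner_commute algebra_simps power2_eq_square)
  ultimately show ?thesis by simp
qed

text \<open>Sum of the two exterior ball inequalities, each point being tested against the ball at
  the other. It yields both the Lipschitz bound for support points and the lower bound for
  curvatures.\<close>

lemma supports_monotone:
  assumes "norm u = 1" "norm v = 1" "supports K u x" "supports K v y"
  shows "(norm (x - y))\<^sup>2 \<le> 2 * w * ((u - v) \<bullet> (x - y))"
  using exterior_ball[OF assms(1,3), of y] exterior_ball[OF assms(2,4), of x] assms(3,4)
  by (simp add: supports_def norm_minus_commute inner_diff_left inner_diff_right algebra_simps)

lemma supports_lipschitz:
  assumes "norm u = 1" "norm v = 1" "supports K u x" "supports K v y"
  shows "norm (x - y) \<le> 2 * w * norm (u - v)"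
proof (cases "x = y")
  case True
  then show ?thesis using w_pos by simp
next
  case False
  have "(norm (x - y))\<^sup>2 \<le> 2 * w * ((u - v) \<bullet> (x - y))"
    by (rule supports_monotone[OF assms])
  also have "\<dots> \<le> 2 * w * (norm (u - v) * norm (x - y))"
    using w_pos by (intro mult_left_mono norm_cauchy_schwarz) auto
  finally show ?thesis
    using False by (simp add: power2_eq_square)
qed

lemma supports_unique:
  assumes "norm u = 1" "supports K u x" "supports K u y"
  shows "x = y"
  using supports_lipschitz[OF assms(1,1,2,3)] by simp

end

section \<open>Odd perturbations of the support function\<close>

text \<open>An odd function of class C^1 with Lipschitz derivative. Oddness preserves the width, and
  vanishing for \<open>\<bar>s\<bar> \<le> c\<close> confines the perturbation to two opposite caps,
  away from the equator orthogonal to \<open>a\<close>. A quadratic Taylor estimate is all the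
  regularity that is used.\<close>

definition bump :: "real \<Rightarrow> real \<Rightarrow> real" where
  "bump c s = (max 0 (s - c))\<^sup>2 - (max 0 (- s - c))\<^sup>2"

definition bump_deriv :: "real \<Rightarrow> real \<Rightarrow> real" where
  "bump_deriv c s = 2 * max 0 (s - c) + 2 * max 0 (- s - c)"

text \<open>The gradient at \<open>u\<close> of the 1-homogeneous extension of \<open>bump c (u \<bullet> a)\<close>; adding \<open>\<epsilon>\<close> times the
  extension to the support function moves the support point at \<open>u\<close> by \<open>\<epsilon>\<close> times this vector.\<close>

definition bump_grad :: "real \<Rightarrow> 'a::real_inner \<Rightarrow> 'a \<Rightarrow> 'a" where
  "bump_grad c a u = bump c (u \<bullet> a) *\<^sub>R u + bump_deriv c (u \<bullet> a) *\<^sub>R (a - (u \<bullet> a) *\<^sub>R u)"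

lemma bump_minus: "bump c (- s) = - bump c s"
  by (simp add: bump_def)

lemma bump_eq_0: "\<bar>s\<bar> \<le> c \<Longrightarrow> bump c s = 0" "\<bar>s\<bar> \<le> c \<Longrightarrow> bump_deriv c s = 0"
  by (auto simp: bump_def bump_deriv_def)

text \<open>The squared positive part is convex and its derivative has Lipschitz constant 2. Because
  the remainder is one-sided, the two remainders subtracted in \<open>bump_taylor\<close> do not
  double the constant.\<close>

lemma square_pos_part_taylor:
  fixes s t :: real
  shows "0 \<le> (max 0 t)\<^sup>2 - (max 0 s)\<^sup>2 - 2 * max 0 s * (t - s)"
    and "(max 0 t)\<^sup>2 - (max 0 s)\<^sup>2 - 2 * max 0 s * (t - s) \<le> (t - s)\<^sup>2"
proof -
  have "0 \<le> (max 0 t)\<^sup>2 - (max 0 s)\<^sup>2 - 2 * max 0 s * (t - s) \<and>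
    (max 0 t)\<^sup>2 - (max 0 s)\<^sup>2 - 2 * max 0 s * (t - s) \<le> (t - s)\<^sup>2"
  proof (cases "s \<ge> 0"; cases "t \<ge> 0")
    assume "s \<ge> 0" "t \<ge> 0"
    then have "(max 0 t)\<^sup>2 - (max 0 s)\<^sup>2 - 2 * max 0 s * (t - s) = (t - s)\<^sup>2"
      by (simp add: max_def power2_eq_square algebra_simps)
    then show ?thesis by simp
  next
    assume "s \<ge> 0" "\<not> t \<ge> 0"
    have "0 \<le> s * (- t)"
      using \<open>s \<ge> 0\<close> \<open>\<not> t \<ge> 0\<close> by (intro mult_nonneg_nonneg) auto
    moreover have "(max 0 t)\<^sup>2 - (max 0 s)\<^sup>2 - 2 * max 0 s * (t - s) = s * s + 2 * (s * (- t))"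
      using \<open>s \<ge> 0\<close> \<open>\<not> t \<ge> 0\<close> by (simp add: max_def power2_eq_square algebra_simps)
    moreover have "(t - s)\<^sup>2 = s * s + 2 * (s * (- t)) + t * t"
      by (simp add: power2_eq_square algebra_simps)
    moreover have "0 \<le> s * s" "0 \<le> t * t" by simp_all
    ultimately show ?thesis by linarith
  next
    assume "\<not> s \<ge> 0" "t \<ge> 0"
    then have "s * t \<le> 0" and "s * s \<ge> 0"
      by (auto simp: mult_nonpos_nonneg)
    then show ?thesis
      using \<open>\<not> s \<ge> 0\<close> \<open>t \<ge> 0\<close> by (simp add: max_def power2_eq_square algebra_simps)
  qed (simp add: max_def)
  then show "0 \<le> (max 0 t)\<^sup>2 - (max 0 s)\<^sup>2 - 2 * max 0 s * (t - s)"
    and "(max 0 t)\<^sup>2 - (max 0 s)\<^sup>2 - 2 * max 0 s * (t - s) \<le> (t - s)\<^sup>2"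
    by auto
qed

lemma bump_taylor: "\<bar>bump c t - bump c s - bump_deriv c s * (t - s)\<bar> \<le> (t - s)\<^sup>2"
proof -
  have "bump c t - bump c s - bump_deriv c s * (t - s) =
    ((max 0 (t - c))\<^sup>2 - (max 0 (s - c))\<^sup>2 - 2 * max 0 (s - c) * ((t - c) - (s - c))) -
    ((max 0 (- t - c))\<^sup>2 - (max 0 (- s - c))\<^sup>2 - 2 * max 0 (- s - c) * ((- t - c) - (- s - c)))"
    by (simp add: bump_def bump_deriv_def algebra_simps)
  moreover have "((- t - c) - (- s - c))\<^sup>2 = (t - s)\<^sup>2" "((t - c) - (s - c))\<^sup>2 = (t - s)\<^sup>2"
    by (simp_all add: power2_eq_square algebra_simps)
  ultimately show ?thesis
    using square_pos_part_taylor[of "t - c" "s - c"] square_pos_part_taylor[of "- t - c" "- s - c"]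
    by linarith
qed

lemma bump_abs_le_1:
  assumes "0 \<le> c" "\<bar>s\<bar> \<le> 1"
  shows "\<bar>bump c s\<bar> \<le> 1"
proof -
  have "(max 0 (s - c))\<^sup>2 \<le> 1" "(max 0 (- s - c))\<^sup>2 \<le> 1"
    using assms by (auto intro!: power_le_one)
  moreover have "0 \<le> (max 0 (s - c))\<^sup>2" "0 \<le> (max 0 (- s - c))\<^sup>2"
    by auto
  ultimately show ?thesis
    unfolding bump_def by linarith
qed

lemma norm_diff_unit:
  fixes u v :: "'a::real_inner"
  assumes "norm u = 1" "norm v = 1"
  shows "(norm (u - v))\<^sup>2 = 2 * (1 - u \<bullet> v)"
  using assms unfolding power2_norm_eq_inner
  by (simp add: inner_diff_left inner_diff_right inner_commute norm_eq_1)

lemma abs_inner_le_1: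
  fixes u v :: "'a::real_inner"
  assumes "norm u = 1" "norm v = 1"
  shows "\<bar>u \<bullet> v\<bar> \<le> 1"
  using Cauchy_Schwarz_ineq2[of u v] assms by simp

lemma inner_bump_grad:
  assumes "norm u = 1"
  shows "u \<bullet> bump_grad c a u = bump c (u \<bullet> a)"
  using assms by (simp add: bump_grad_def inner_add_right inner_diff_right norm_eq_1)

text \<open>As \<open>bump_grad\<close> is the gradient of the homogeneous extension, the left side
  vanishes to first order at \<open>v = u\<close>, and \<open>1 - u \<bullet> v\<close> is half the
  squared distance. The constant 7 is 5 + 2: 5 bounds \<open>bump c s - s * bump_deriv c s\<close>
  by 1 + 4, and 2 comes from the Taylor remainder.\<close>

lemma bump_grad_quadratic:
  fixes u v a :: "'a::real_inner"
  assumes "norm u = 1" "norm v = 1" "norm a = 1" "0 \<le> c"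
  shows "\<bar>v \<bullet> bump_grad c a u - bump c (v \<bullet> a)\<bar> \<le> 7 * (1 - u \<bullet> v)"
proof -
  define s t where "s = u \<bullet> a" and "t = v \<bullet> a"
  have s: "\<bar>s\<bar> \<le> 1" and uv: "u \<bullet> v \<le> 1"
    using abs_inner_le_1 assms unfolding s_def by (auto simp: abs_le_iff)
  have f: "\<bar>bump c s\<bar> \<le> 1"
    using assms s by (intro bump_abs_le_1)
  have "\<bar>bump_deriv c s\<bar> \<le> 4"
    using assms s by (auto simp: bump_deriv_def max_def)
  then have "\<bar>s * bump_deriv c s\<bar> \<le> 1 * 4"
    unfolding abs_mult using s by (intro mult_mono) auto
  then have "\<bar>bump c s - s * bump_deriv c s\<bar> \<le> 5"
    using f by linarith
  then have A: "\<bar>(1 - u \<bullet> v) * (bump c s - s * bump_deriv c s)\<bar> \<le> (1 - u \<bullet> v) * 5"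
    unfolding abs_mult using uv by (intro mult_mono) auto
  have "\<bar>t - s\<bar> \<le> norm (v - u)"
    using Cauchy_Schwarz_ineq2[of "v - u" a] assms by (simp add: s_def t_def inner_diff_left)
  then have "(t - s)\<^sup>2 \<le> (norm (v - u))\<^sup>2"
    using power_mono[of "\<bar>t - s\<bar>" _ 2] by simp
  also have "\<dots> = 2 * (1 - u \<bullet> v)"
    using norm_diff_unit[OF assms(2,1)] by (simp add: inner_commute)
  finally have B: "\<bar>bump c t - bump c s - bump_deriv c s * (t - s)\<bar> \<le> 2 * (1 - u \<bullet> v)"
    using bump_taylor[of c t s] by linarith
  have "v \<bullet> bump_grad c a u - bump c t =
    - (bump c t - bump c s - bump_deriv c s * (t - s)) - (1 - u \<bullet> v) * (bump c s - s * bump_deriv c s)"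
    by (simp add: bump_grad_def s_def t_def inner_add_right inner_diff_right
        inner_commute algebra_simps)
  then show ?thesis
    using A B unfolding t_def by linarith
qed

text \<open>The Wulff shape of the perturbed support function. Its support function is in general
  only bounded above by the prescribed one; equality is what
  \<open>support_fun_perturbed_body\<close> establishes for small \<open>\<epsilon>\<close>.\<close>

definition perturbed_body :: "'a::euclidean_space set \<Rightarrow> real \<Rightarrow> 'a \<Rightarrow> real \<Rightarrow> 'a set" where
  "perturbed_body K c a \<epsilon> =
     {x. \<forall>v. norm v = 1 \<longrightarrow> v \<bullet> x \<le> support_fun K v + \<epsilon> * bump c (v \<bullet> a)}"

text \<open>The ball of radius \<open>r\<close> around \<open>x - r u\<close> has support value
  \<open>v \<bullet> x + r * (1 - u \<bullet> v)\<close> at \<open>v\<close>, so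
  \<open>interior_balls\<close> says that this ball lies in \<open>K\<close>. It is required on both
  caps \<open>\<bar>u \<bullet> a\<bar> > c0\<close>, which are larger than the caps carrying the
  bump; the gap \<open>c - c0\<close> handles pairs with one direction outside the larger
  caps.\<close>

locale perturbable_body = constant_width_body K w
  for K :: "'a::euclidean_space set" and w +
  fixes a :: 'a and c0 c r :: real
  assumes a: "norm a = 1" and c0: "0 \<le> c0" "c0 < c" and r: "r > 0"
    and interior_balls: "\<And>u x v. norm u = 1 \<Longrightarrow> norm v = 1 \<Longrightarrow> \<bar>u \<bullet> a\<bar> > c0 \<Longrightarrow>
      supports K u x \<Longrightarrow> r * (1 - u \<bullet> v) \<le> support_fun K v - v \<bullet> x"
begin

text \<open>The candidate support point at \<open>u\<close> respects every half-space of the Wulff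
  shape. If \<open>u\<close> is in a large cap, the interior ball absorbs the quadratic error of the
  bump. Otherwise the point does not move, and the only danger is a \<open>v\<close> where the bump
  is active; such a \<open>v\<close> is at distance at least \<open>c - c0\<close> from
  \<open>u\<close>, which leaves a fixed positive slack.\<close>

lemma perturbed_inner_le:
  assumes u: "norm u = 1" and v: "norm v = 1" and x: "supports K u x"
    and e: "7 * \<bar>\<epsilon>\<bar> \<le> r" "\<bar>\<epsilon>\<bar> \<le> (r * (c - c0)\<^sup>2 / 2)\<^sup>2 / (4 * w)"
  shows "v \<bullet> (x + \<epsilon> *\<^sub>R bump_grad c a u) \<le> support_fun K v + \<epsilon> * bump c (v \<bullet> a)"
proof (cases "\<bar>u \<bullet> a\<bar> > c0")
  case True
  have c: "0 \<le> c" using c0 by simp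
  have uv: "0 \<le> 1 - u \<bullet> v"
    using abs_inner_le_1[OF u v] by simp
  have "\<epsilon> * (v \<bullet> bump_grad c a u - bump c (v \<bullet> a)) \<le> \<bar>\<epsilon>\<bar> * \<bar>v \<bullet> bump_grad c a u - bump c (v \<bullet> a)\<bar>"
    by (metis abs_ge_self abs_mult)
  also have "\<dots> \<le> \<bar>\<epsilon>\<bar> * (7 * (1 - u \<bullet> v))"
    using bump_grad_quadratic[OF u v a c] by (intro mult_left_mono) auto
  also have "\<dots> = (7 * \<bar>\<epsilon>\<bar>) * (1 - u \<bullet> v)" by simp
  also have "\<dots> \<le> r * (1 - u \<bullet> v)"
    using e uv by (intro mult_right_mono)
  also have "\<dots> \<le> support_fun K v - v \<bullet> x"
    using interior_balls[OF u v True x] .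
  finally show ?thesis
    by (simp add: inner_add_right algebra_simps)
next
  case False
  then have g: "bump_grad c a u = 0"
    using c0 by (simp add: bump_grad_def bump_eq_0)
  have le: "v \<bullet> x \<le> support_fun K v"
    using x by (intro inner_le_support_fun compact_body) (simp add: supports_def)
  show ?thesis
  proof (cases "\<bar>v \<bullet> a\<bar> \<le> c")
    case True
    then show ?thesis using g le by (simp add: bump_eq_0)
  next
    case vc: False
    obtain y where y: "supports K v y"
      using supports_exists compact_body nonempty_body by blast
    have "c - c0 \<le> \<bar>(v - u) \<bullet> a\<bar>"
      using False vc by (simp add: inner_diff_left)
    also have "\<dots> \<le> norm (v - u)"
      using Cauchy_Schwarz_ineq2[of "v - u" a] a by simp
    finally have "(c - c0)\<^sup>2 \<le> (norm (v - u))\<^sup>2"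
      using c0 by (intro power_mono) auto
    then have "r * (c - c0)\<^sup>2 / 2 \<le> r * (1 - v \<bullet> u)"
      using norm_diff_unit[OF v u] r by simp
    \<comment> \<open>The interior ball at \<open>y\<close>, the support point for \<open>v\<close>,
      is read in the direction \<open>u\<close>: it keeps \<open>y\<close> strictly below the
      supporting plane at \<open>x\<close>.\<close>
    also have "\<dots> \<le> u \<bullet> (x - y)"
      using interior_balls[OF v u _ y] vc c0 x by (simp add: supports_def inner_diff_right)
    also have "\<dots> \<le> norm (x - y)"
      using norm_cauchy_schwarz[of u "x - y"] u by simp
    finally have "(r * (c - c0)\<^sup>2 / 2)\<^sup>2 \<le> (norm (x - y))\<^sup>2"
      using r by (intro power_mono) auto
    \<comment> \<open>The exterior ball at \<open>y\<close> turns this separation of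
      \<open>x\<close> and \<open>y\<close> into depth of \<open>x\<close> below the supporting
      plane for \<open>v\<close>. The result is the second threshold imposed on
      \<open>\<epsilon>\<close>.\<close>
    also have "\<dots> \<le> 4 * w * (v \<bullet> (y - x))"
      using x y by (intro exterior_ball v) (simp_all add: supports_def)
    also have "v \<bullet> (y - x) = support_fun K v - v \<bullet> x"
      using y by (simp add: supports_def inner_diff_right)
    finally have "(r * (c - c0)\<^sup>2 / 2)\<^sup>2 / (4 * w) \<le> support_fun K v - v \<bullet> x"
      using w_pos by (simp add: divide_le_eq mult.commute)
    moreover have "\<bar>\<epsilon> * bump c (v \<bullet> a)\<bar> \<le> \<bar>\<epsilon>\<bar> * 1"
      unfolding abs_mult using c0 abs_inner_le_1[OF v a]
      by (intro mult_left_mono bump_abs_le_1) auto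
    ultimately show ?thesis
      using e g by simp
  qed
qed

context
  fixes \<epsilon> :: real
  assumes e: "7 * \<bar>\<epsilon>\<bar> \<le> r" "\<bar>\<epsilon>\<bar> \<le> (r * (c - c0)\<^sup>2 / 2)\<^sup>2 / (4 * w)"
begin

lemma support_fun_perturbed_body:
  assumes u: "norm u = 1" and x: "supports K u x"
  shows "supports (perturbed_body K c a \<epsilon>) u (x + \<epsilon> *\<^sub>R bump_grad c a u)"
    and "support_fun (perturbed_body K c a \<epsilon>) u = support_fun K u + \<epsilon> * bump c (u \<bullet> a)"
proof -
  let ?x = "x + \<epsilon> *\<^sub>R bump_grad c a u"
  have mem: "?x \<in> perturbed_body K c a \<epsilon>"
    unfolding perturbed_body_def using perturbed_inner_le[OF u _ x e] by auto
  have eq: "u \<bullet> ?x = support_fun K u + \<epsilon> * bump c (u \<bullet> a)"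
    using x inner_bump_grad[OF u] by (simp add: inner_add_right supports_def)
  show "support_fun (perturbed_body K c a \<epsilon>) u = support_fun K u + \<epsilon> * bump c (u \<bullet> a)"
    using u by (intro support_fun_eqI[OF mem eq]) (simp add: perturbed_body_def)
  with mem eq show "supports (perturbed_body K c a \<epsilon>) u ?x"
    by (simp add: supports_def)
qed

lemma compact_perturbed_body: "compact (perturbed_body K c a \<epsilon>)"
proof -
  have "perturbed_body K c a \<epsilon> =
    (\<Inter>v\<in>{v. norm v = 1}. {x. v \<bullet> x \<le> support_fun K v + \<epsilon> * bump c (v \<bullet> a)})"
    by (auto simp: perturbed_body_def)
  then have "closed (perturbed_body K c a \<epsilon>)"
    by (auto intro!: closed_INT closed_halfspace_le)
  moreover obtain R where R: "\<And>x. x \<in> K \<Longrightarrow> norm x \<le> R"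
    using compact_imp_bounded[OF compact_body] by (auto simp: bounded_iff)
  have "norm x \<le> max 0 (R + \<bar>\<epsilon>\<bar>)" if "x \<in> perturbed_body K c a \<epsilon>" for x
  proof (cases "x = 0")
    case False
    define v where "v = sgn x"
    have v: "norm v = 1" using False by (simp add: v_def norm_sgn)
    obtain y where y: "supports K v y"
      using supports_exists compact_body nonempty_body by blast
    have "norm x = v \<bullet> x"
      using False by (simp add: v_def sgn_div_norm power2_norm_eq_inner[symmetric] power2_eq_square)
    also have "\<dots> \<le> v \<bullet> y + \<epsilon> * bump c (v \<bullet> a)"
      using that v y by (simp add: perturbed_body_def supports_def)
    also have "v \<bullet> y \<le> R"
      using norm_cauchy_schwarz[of v y] v R[of y] y by (simp add: supports_def)
    also have "\<epsilon> * bump c (v \<bullet> a) \<le> \<bar>\<epsilon>\<bar> * \<bar>bump c (v \<bullet> a)\<bar>"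
      by (metis abs_ge_self abs_mult)
    also have "\<dots> \<le> \<bar>\<epsilon>\<bar> * 1"
      using c0 abs_inner_le_1[OF v a] by (intro mult_left_mono bump_abs_le_1) auto
    finally show ?thesis by simp
  qed simp
  then have "bounded (perturbed_body K c a \<epsilon>)"
    by (auto simp: bounded_iff)
  ultimately show ?thesis
    by (simp add: compact_eq_bounded_closed)
qed

lemma convex_perturbed_body: "convex (perturbed_body K c a \<epsilon>)"
proof -
  have "perturbed_body K c a \<epsilon> =
    (\<Inter>v\<in>{v. norm v = 1}. {x. v \<bullet> x \<le> support_fun K v + \<epsilon> * bump c (v \<bullet> a)})"
    by (auto simp: perturbed_body_def)
  then show ?thesis
    by (auto intro!: convex_INT convex_halfspace_le)
qed

lemma perturbed_body_nonempty: "perturbed_body K c a \<epsilon> \<noteq> {}"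
proof -
  obtain x where "supports K a x"
    using supports_exists compact_body nonempty_body by blast
  with support_fun_perturbed_body(1)[OF a] show ?thesis
    by (auto simp: supports_def)
qed

lemma interior_perturbed_body:
  assumes "cball z \<rho> \<subseteq> K" "\<bar>\<epsilon>\<bar> < \<rho>"
  shows "z \<in> interior (perturbed_body K c a \<epsilon>)"
proof -
  have "ball z (\<rho> - \<bar>\<epsilon>\<bar>) \<subseteq> perturbed_body K c a \<epsilon>"
  proof
    fix y assume y: "y \<in> ball z (\<rho> - \<bar>\<epsilon>\<bar>)"
    show "y \<in> perturbed_body K c a \<epsilon>"
      unfolding perturbed_body_def
    proof (intro CollectI allI impI)
      fix v :: 'a assume v: "norm v = 1"
      have "v \<bullet> (y - z) \<le> norm (y - z)"
        using norm_cauchy_schwarz[of v "y - z"] v by simp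
      then have "v \<bullet> y \<le> v \<bullet> z + \<rho> - \<bar>\<epsilon>\<bar>"
        using y by (simp add: inner_diff_right dist_norm norm_minus_commute)
      moreover have "v \<bullet> z + \<rho> = v \<bullet> (z + \<rho> *\<^sub>R v)"
        using v by (simp add: inner_add_right norm_eq_1)
      moreover have "\<dots> \<le> support_fun K v"
        using assms v by (intro inner_le_support_fun compact_body) (auto simp: dist_norm)
      moreover have "\<bar>\<epsilon> * bump c (v \<bullet> a)\<bar> \<le> \<bar>\<epsilon>\<bar> * 1"
        unfolding abs_mult using c0 abs_inner_le_1[OF v a]
        by (intro mult_left_mono bump_abs_le_1) auto
      ultimately show "v \<bullet> y \<le> support_fun K v + \<epsilon> * bump c (v \<bullet> a)"
        by simp
    qed
  qed
  then show ?thesis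
    using assms by (auto simp: interior_def intro!: exI[of _ "ball z (\<rho> - \<bar>\<epsilon>\<bar>)"])
qed

text \<open>The perturbations at \<open>u\<close> and \<open>- u\<close> cancel in the sum of
  support values, since the bump is odd.\<close>

lemma perturbed_body_constant_width: "has_constant_width (perturbed_body K c a \<epsilon>) (2 * w)"
  unfolding has_constant_width_def
proof (intro allI impI)
  fix u :: 'a assume u: "norm u = 1"
  then have u': "norm (- u) = 1" by simp
  obtain x y where "supports K u x" "supports K (- u) y"
    using supports_exists compact_body nonempty_body by metis
  then show "body_width (perturbed_body K c a \<epsilon>) u = 2 * w"
    using body_width_eq_support_fun[OF compact_perturbed_body perturbed_body_nonempty u]
      support_fun_perturbed_body(2)[OF u] support_fun_perturbed_body(2)[OF u'] support_fun_minus[OF u]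
    by (simp add: bump_minus)
qed

lemma hausdorff_distance_perturbed_body: "hausdorff_distance K (perturbed_body K c a \<epsilon>) \<le> \<bar>\<epsilon>\<bar>"
proof (rule hausdorff_distance_le_of_support_fun)
  fix v :: 'a assume v: "norm v = 1"
  obtain x where x: "supports K v x"
    using supports_exists compact_body nonempty_body by blast
  have "\<bar>\<epsilon> * bump c (v \<bullet> a)\<bar> \<le> \<bar>\<epsilon>\<bar> * 1"
    unfolding abs_mult using c0 abs_inner_le_1[OF v a]
    by (intro mult_left_mono bump_abs_le_1) auto
  then show "\<bar>support_fun K v - support_fun (perturbed_body K c a \<epsilon>) v\<bar> \<le> \<bar>\<epsilon>\<bar>"
    using support_fun_perturbed_body(2)[OF v x] by simp
qed (use compact_body convex_body nonempty_body compact_perturbed_body convex_perturbed_body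
      perturbed_body_nonempty in auto)

end

end

section \<open>Averaging along fibres\<close>

lemma compact_convex_real_interval:
  fixes S :: "real set"
  assumes "compact S" "convex S" "S \<noteq> {}"
  obtains \<alpha> \<beta> where "\<alpha> \<le> \<beta>" "S = {\<alpha>..\<beta>}"
  using assms connected_compact_interval_1[of S] convex_connected[of S] by force

text \<open>Over each \<open>y\<close> the fibre of \<open>A\<close> is the Minkowski average of two
  compact intervals, whose length is exactly the mean of their lengths; integrating over
  \<open>y\<close> gives the volumes. Equal shadows exclude fibres that are empty in only one of the
  two sets, for which the identity would fail.\<close>

lemma emeasure_fibre_average:
  fixes K L :: "('a::euclidean_space \<times> real) set"
  assumes K: "compact K" "convex K" and L: "compact L" "convex L" and fst: "fst ` K = fst ` L"
  defines "A \<equiv> {(y, (s + t) / 2) | y s t. (y, s) \<in> K \<and> (y, t) \<in> L}"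
  shows "compact A" and "2 * emeasure lborel A = emeasure lborel K + emeasure lborel L"
proof -
  define D where "D = (K \<times> L) \<inter> {p. fst (fst p) = fst (snd p)}"
  have "closed {p :: ('a \<times> real) \<times> ('a \<times> real). fst (fst p) = fst (snd p)}"
    by (intro closed_Collect_eq continuous_intros)
  then have "compact D"
    unfolding D_def using K L by (intro compact_Int_closed compact_Times)
  moreover have "A = (\<lambda>p. (fst (fst p), (snd (fst p) + snd (snd p)) / 2)) ` D" (is "_ = ?f ` D")
  proof (intro equalityI subsetI)
    fix p assume "p \<in> A"
    then obtain y s t where "p = ?f ((y, s), (y, t))" "((y, s), (y, t)) \<in> D"
      unfolding A_def D_def by auto
    then show "p \<in> ?f ` D" by blast
  next
    fix p assume "p \<in> ?f ` D"
    then obtain q where q: "q \<in> D" "p = ?f q" by blast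
    obtain y s y' t where "q = ((y, s), (y', t))" by (metis surj_pair)
    then show "p \<in> A" using q unfolding A_def D_def by auto
  qed
  ultimately show A: "compact A"
    by (auto intro!: compact_continuous_image continuous_intros)
  have slice_compact: "compact (Pair y -` C)" if "compact C" for C :: "('a \<times> real) set" and y
  proof -
    have "Pair y -` C = snd ` (C \<inter> ({y} \<times> UNIV))"
      by (auto simp: image_iff Bex_def)
    moreover have "compact (C \<inter> ({y} \<times> UNIV))"
      using that by (intro compact_Int_closed closed_Times) auto
    ultimately show ?thesis
      by (auto intro!: compact_continuous_image continuous_intros)
  qed
  have slice_convex: "convex (Pair y -` C)" if "convex C" for C :: "('a \<times> real) set" and y
  proof (rule convexI)
    fix s t u v :: real
    assume "s \<in> Pair y -` C" "t \<in> Pair y -` C" "0 \<le> u" "0 \<le> v" "u + v = 1"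
    then have "u *\<^sub>R (y, s) + v *\<^sub>R (y, t) \<in> C"
      using that by (intro convexD) auto
    moreover have "u *\<^sub>R (y, s) + v *\<^sub>R (y, t) = (y, u *\<^sub>R s + v *\<^sub>R t)"
      using \<open>u + v = 1\<close> by (simp flip: scaleR_add_left)
    ultimately show "u *\<^sub>R s + v *\<^sub>R t \<in> Pair y -` C" by simp
  qed
  have slices: "2 * emeasure lborel (Pair y -` A) =
    emeasure lborel (Pair y -` K) + emeasure lborel (Pair y -` L)" for y
  proof (cases "y \<in> fst ` K")
    case False
    then have "y \<notin> fst ` L" using fst by simp
    with False have e: "(y, s) \<notin> K" "(y, s) \<notin> L" for s
      by (metis fst_conv imageI)+
    then have "Pair y -` K = {}" "Pair y -` L = {}" "Pair y -` A = {}"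
      unfolding A_def by auto
    then show ?thesis by simp
  next
    case True
    then have "y \<in> fst ` L" using fst by simp
    with True have "Pair y -` K \<noteq> {}" "Pair y -` L \<noteq> {}"
      by auto
    then obtain k1 k2 l1 l2 where kl: "k1 \<le> k2" "Pair y -` K = {k1..k2}" "l1 \<le> l2" "Pair y -` L = {l1..l2}"
      using compact_convex_real_interval slice_compact slice_convex K L by metis
    have "Pair y -` A = {(k1 + l1) / 2..(k2 + l2) / 2}"
    proof (intro equalityI subsetI)
      fix z assume "z \<in> Pair y -` A"
      then obtain s t where "z = (s + t) / 2" "s \<in> Pair y -` K" "t \<in> Pair y -` L"
        by (auto simp: A_def)
      then show "z \<in> {(k1 + l1) / 2..(k2 + l2) / 2}"
        unfolding kl by auto
    next
      fix z assume z: "z \<in> {(k1 + l1) / 2..(k2 + l2) / 2}"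
      \<comment> \<open>The largest admissible first endpoint: then \<open>2 * z - s\<close> is the
        maximum of \<open>2 * z - k2\<close> and \<open>l1\<close>, which lies between
        \<open>l1\<close> and \<open>l2\<close>.\<close>
      define s where "s = min k2 (2 * z - l1)"
      have "s \<in> Pair y -` K" "2 * z - s \<in> Pair y -` L"
        unfolding kl s_def using z kl(1,3) by (auto simp: min_def field_simps)
      moreover have "z = (s + (2 * z - s)) / 2" by simp
      ultimately show "z \<in> Pair y -` A"
        unfolding A_def vimage_def by blast
    qed
    moreover have "2 * ennreal ((k2 + l2) / 2 - (k1 + l1) / 2) = ennreal (k2 - k1) + ennreal (l2 - l1)"
      using kl(1,3) by (simp flip: ennreal_plus ennreal_numeral ennreal_mult' add: field_simps)
    ultimately show ?thesis
      using kl by simp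
  qed
  have sets: "C \<in> sets (lborel \<Otimes>\<^sub>M lborel)" if "compact C" for C :: "('a \<times> real) set"
    unfolding lborel_prod using that by (simp add: borel_compact)
  have fubini: "emeasure lborel C = (\<integral>\<^sup>+y. emeasure lborel (Pair y -` C) \<partial>lborel)"
    if "compact C" for C :: "('a \<times> real) set"
    using lborel.emeasure_pair_measure_alt[OF sets[OF that]] by (simp add: lborel_prod)
  have meas: "(\<lambda>y. emeasure lborel (Pair y -` C)) \<in> borel_measurable lborel"
    if "compact C" for C :: "('a \<times> real) set"
    by (rule lborel.measurable_emeasure_Pair[OF sets[OF that]])
  have "2 * emeasure lborel A = (\<integral>\<^sup>+y. 2 * emeasure lborel (Pair y -` A) \<partial>lborel)"
    unfolding fubini[OF A] by (rule nn_integral_cmult[symmetric, OF meas[OF A]])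
  also have "\<dots> = emeasure lborel K + emeasure lborel L"
    unfolding slices fubini[OF K(1)] fubini[OF L(1)]
    by (rule nn_integral_add[OF meas[OF K(1)] meas[OF L(1)]])
  finally show "2 * emeasure lborel A = emeasure lborel K + emeasure lborel L" .
qed

section \<open>Volume-preserving coordinates of three-space with fibres along a given
  direction\<close>

definition stack3 :: "(real \<times> real) \<times> real \<Rightarrow> real^3" where
  "stack3 p = vector [fst (fst p), snd (fst p), snd p]"

lemma stack3_nth [simp]:
  "stack3 p $ 1 = fst (fst p)" "stack3 p $ 2 = snd (fst p)" "stack3 p $ 3 = snd p"
  by (simp_all add: stack3_def)

lemma linear_stack3: "linear stack3"
  by (rule linearI) (simp_all add: vec_eq_iff forall_3)

lemma bij_stack3: "bij stack3"
proof (rule bij_betw_byWitness[where f' = "\<lambda>x. ((x $ 1, x $ 2), x $ 3)"])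
qed (auto simp: vec_eq_iff forall_3)

lemma continuous_on_stack3: "continuous_on S stack3"
  using linear_stack3 by (simp add: linear_continuous_on linear_conv_bounded_linear)

lemma measurable_stack3 [measurable]: "stack3 \<in> borel_measurable borel"
  by (intro borel_measurable_continuous_onI continuous_on_stack3)

text \<open>Lebesgue measure is determined by its values on boxes, and the preimage of a box is a
  product of three intervals with the same side lengths.\<close>

lemma distr_stack3: "distr lborel borel stack3 = lborel"
proof (rule lborel_eqI[symmetric])
  fix l u :: "real^3" assume lu: "\<And>b. b \<in> Basis \<Longrightarrow> l \<bullet> b \<le> u \<bullet> b"
  have le: "l $ i \<le> u $ i" for i
    using lu[of "axis i 1"] by (simp add: inner_axis)
  have vim: "stack3 -` box l u = (box (l $ 1) (u $ 1) \<times> box (l $ 2) (u $ 2)) \<times> box (l $ 3) (u $ 3)"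
    by (simp add: set_eq_iff mem_box_cart forall_3 mem_Times_iff conj_ac)
  have "emeasure (distr lborel borel stack3) (box l u) =
      emeasure lborel ((box (l $ 1) (u $ 1) \<times> box (l $ 2) (u $ 2)) \<times> box (l $ 3) (u $ 3))"
    by (subst emeasure_distr) (auto simp: vim)
  also have "\<dots> = ennreal ((u $ 1 - l $ 1) * (u $ 2 - l $ 2) * (u $ 3 - l $ 3))"
    using le by (simp add: lborel_prod[symmetric] lborel.emeasure_pair_measure_Times ennreal_mult)
  also have "(u $ 1 - l $ 1) * (u $ 2 - l $ 2) * (u $ 3 - l $ 3) = (\<Prod>b\<in>Basis. (u - l) \<bullet> b)"
  proof -
    have B: "(Basis :: (real^3) set) = (\<lambda>i. axis i 1) ` UNIV"
      by (auto simp: Basis_vec_def)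
    have "inj (\<lambda>i::3. axis i (1::real))"
      by (simp add: inj_def axis_eq_axis)
    then have "(\<Prod>b\<in>Basis. (u - l) \<bullet> b) = (\<Prod>i\<in>UNIV. (u - l) \<bullet> axis i 1)"
      unfolding B by (rule prod.reindex[unfolded o_def])
    also have "\<dots> = (\<Prod>i\<in>UNIV. u $ i - l $ i)"
      by (simp add: inner_axis)
    also have "\<dots> = (u $ 1 - l $ 1) * (u $ 2 - l $ 2) * (u $ 3 - l $ 3)"
      unfolding UNIV_3 by simp
    finally show ?thesis by simp
  qed
  finally show "emeasure (distr lborel borel stack3) (box l u) = ennreal (\<Prod>b\<in>Basis. (u - l) \<bullet> b)" .
qed simp

text \<open>If the line through \<open>x\<close> in direction \<open>a\<close> missed
  \<open>L\<close>, a hyperplane would separate them. A linear functional bounded below on a line is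
  constant along it, so its normal is orthogonal to \<open>a\<close>, where the support functions
  are assumed to be ordered. Thus comparing support functions on the equator compares
  shadows.\<close>

lemma line_meets_of_support_fun_le:
  fixes K L :: "'a::euclidean_space set"
  assumes K: "compact K" and L: "compact L" "convex L" "L \<noteq> {}"
    and le: "\<And>v. norm v = 1 \<Longrightarrow> v \<bullet> a = 0 \<Longrightarrow> support_fun K v \<le> support_fun L v" and x: "x \<in> K"
  shows "\<exists>\<tau>. x + \<tau> *\<^sub>R a \<in> L"
proof (rule ccontr)
  assume no: "\<nexists>\<tau>. x + \<tau> *\<^sub>R a \<in> L"
  define M where "M = range (\<lambda>\<tau>. x + \<tau> *\<^sub>R a)"
  have M: "M = (+) x ` span {a}"
    unfolding M_def span_singleton by (simp add: image_image)
  have "closed M" "convex M"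
    unfolding M by (auto intro!: closed_translation closed_span convex_translation
        subspace_imp_convex subspace_span)
  then obtain v b where vb: "\<forall>y\<in>L. v \<bullet> y < b" "\<forall>y\<in>M. v \<bullet> y > b"
    using separating_hyperplane_compact_closed[of L M] L no by (auto simp: M_def)
  have va: "v \<bullet> a = 0"
  proof (rule ccontr)
    assume "v \<bullet> a \<noteq> 0"
    then have "v \<bullet> (x + ((b - v \<bullet> x) / (v \<bullet> a)) *\<^sub>R a) = b"
      by (simp add: inner_add_right)
    then show False
      using vb(2) unfolding M_def by (metis less_irrefl rangeI)
  qed
  have vx: "v \<bullet> x > b"
    using vb(2) unfolding M_def by (metis add.right_neutral rangeI scale_zero_left)
  obtain z where "z \<in> L" using L by blast
  then have "v \<noteq> 0" using vb vx by force
  define e where "e = sgn v"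
  have e: "norm e = 1" "e \<bullet> a = 0"
    using \<open>v \<noteq> 0\<close> va by (auto simp: e_def norm_sgn sgn_div_norm)
  obtain y where y: "supports L e y"
    using supports_exists L by blast
  have "e \<bullet> x \<le> e \<bullet> y"
    using inner_le_support_fun[OF K x, of e] le[OF e] y by (simp add: supports_def)
  then have "v \<bullet> x \<le> v \<bullet> y"
    using \<open>v \<noteq> 0\<close> by (simp add: e_def sgn_div_norm divide_le_cancel)
  then show False
    using vb(1) vx y by (force simp: supports_def)
qed

text \<open>A rotation \<open>R\<close> carries the third axis to \<open>a\<close>, so that
  \<open>F\<close> preserves volume and maps vertical fibres to lines parallel to \<open>a\<close>.
  Pulling everything back by \<open>F\<close> reduces the claim to averages along the last
  coordinate.\<close>

lemma measure_line_average:
  fixes K L :: "(real^3) set" and a :: "real^3"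
  assumes K: "compact K" "convex K" and L: "compact L" "convex L" and a: "norm a = 1"
    and KL: "\<And>x. x \<in> K \<Longrightarrow> \<exists>\<tau>. x + \<tau> *\<^sub>R a \<in> L" and LK: "\<And>x. x \<in> L \<Longrightarrow> \<exists>\<tau>. x + \<tau> *\<^sub>R a \<in> K"
  defines "A \<equiv> {(1/2) *\<^sub>R (x + y) | x y. x \<in> K \<and> y \<in> L \<and> (\<exists>\<tau>. x = y + \<tau> *\<^sub>R a)}"
  shows "compact A" and "2 * measure lebesgue A = measure lebesgue K + measure lebesgue L"
proof -
  obtain R :: "real^3 \<Rightarrow> real^3" where R: "orthogonal_transformation R" "R (axis (3::3) 1) = a"
    using orthogonal_transformation_exists_1[of "axis (3::3) (1::real)" a] a
    by (auto simp: norm_axis_1)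
  define F where "F = R \<circ> stack3"
  have linR: "linear R" using R by (simp add: orthogonal_transformation_linear)
  have linF: "linear F"
    unfolding F_def by (intro linear_compose linear_stack3 linR)
  have bijF: "bij F"
    unfolding F_def using R bij_stack3 by (intro bij_comp orthogonal_transformation_bij)
  have Fa: "F (0, t) = t *\<^sub>R a" for t
  proof -
    have "stack3 (0, t) = t *\<^sub>R axis 3 1"
      by (simp add: vec_eq_iff forall_3 axis_def zero_prod_def)
    then show ?thesis
      using R linR by (simp add: F_def linear_scale)
  qed
  have Fsplit: "F (y, t) = F (y, s) + (t - s) *\<^sub>R a" for y s t
    unfolding Fa[symmetric] linear_add[OF linF, symmetric] by simp
  have cont: "continuous_on S F" for S
    using linF by (simp add: linear_continuous_on linear_conv_bounded_linear)
  have vim: "F -` C = inv F ` C" for C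
    using bijF by (simp add: bij_vimage_eq_inv_image)
  have lininv: "linear (inv F)"
  proof (rule linearI)
    have surj: "F (inv F x) = x" for x
      using bijF by (simp add: bij_is_surj surj_f_inv_f)
    show "inv F (x + y) = inv F x + inv F y" for x y
      using bijF by (intro inv_f_eq) (simp_all add: bij_is_inj linear_add[OF linF] surj)
    show "inv F (k *\<^sub>R x) = k *\<^sub>R inv F x" for k x
      using bijF by (intro inv_f_eq) (simp_all add: bij_is_inj linear_scale[OF linF] surj)
  qed
  have comp: "compact (F -` C)" if "compact C" for C
    unfolding vim using that lininv
    by (intro compact_continuous_image linear_continuous_on) (auto simp: linear_conv_bounded_linear)
  have conv: "convex (F -` C)" if "convex C" for C
    by (rule convex_linear_vimage[OF linF that])
  have meas: "measure lebesgue C = measure lborel (F -` C)" if "compact C" for C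
  proof -
    have F: "R ` (stack3 ` (F -` C)) = C"
      using surj_image_vimage_eq[OF bij_is_surj[OF bijF], of C] by (simp add: F_def image_comp)
    have cs: "compact (stack3 ` (F -` C))"
      by (intro compact_continuous_image comp that continuous_on_stack3)
    have "measure lebesgue C = measure lebesgue (stack3 ` (F -` C))"
      using measure_orthogonal_image[OF R(1) lmeasurable_compact[OF cs]] F by simp
    also have "\<dots> = measure lborel (stack3 ` (F -` C))"
      using cs by (simp add: borel_compact measure_completion)
    also have "\<dots> = measure (distr lborel borel stack3) (stack3 ` (F -` C))"
      by (simp add: distr_stack3)
    also have "\<dots> = measure lborel (stack3 -` (stack3 ` (F -` C)))"
      using cs by (subst measure_distr) (auto simp: borel_compact)
    also have "stack3 -` (stack3 ` (F -` C)) = F -` C"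
      using bij_stack3 by (simp add: bij_is_inj inj_vimage_image_eq)
    finally show ?thesis .
  qed
  have shadow: "fst ` (F -` C) \<subseteq> fst ` (F -` D)" if CD: "\<And>x. x \<in> C \<Longrightarrow> \<exists>\<tau>. x + \<tau> *\<^sub>R a \<in> D" for C D
  proof
    fix y assume "y \<in> fst ` (F -` C)"
    then obtain t where "F (y, t) \<in> C" by auto
    then obtain \<tau> where "F (y, t) + \<tau> *\<^sub>R a \<in> D" using CD by blast
    then have "F (y, t + \<tau>) \<in> D" using Fsplit[of y "t + \<tau>" t] by simp
    then show "y \<in> fst ` (F -` D)" by force
  qed
  have fst: "fst ` (F -` K) = fst ` (F -` L)"
    using shadow KL LK by (intro equalityI) auto
  have FA: "F -` A = {(y, (s + t) / 2) | y s t. (y, s) \<in> F -` K \<and> (y, t) \<in> F -` L}" (is "_ = ?A'")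
  proof (intro equalityI subsetI)
    fix p assume "p \<in> ?A'"
    then obtain y s t where p: "p = (y, (s + t) / 2)" "F (y, s) \<in> K" "F (y, t) \<in> L" by auto
    have "\<exists>\<tau>. F (y, s) = F (y, t) + \<tau> *\<^sub>R a"
      using Fsplit by blast
    moreover have "F p = (1/2) *\<^sub>R (F (y, s) + F (y, t))"
      unfolding p(1) linear_add[OF linF, symmetric] linear_scale[OF linF, symmetric]
      by (simp add: add_divide_distrib)
    ultimately show "p \<in> F -` A" unfolding A_def using p by auto
  next
    fix p assume "p \<in> F -` A"
    then obtain x1 x2 \<tau> where x: "F p = (1/2) *\<^sub>R (x1 + x2)" "x1 \<in> K" "x2 \<in> L" "x1 = x2 + \<tau> *\<^sub>R a"
      by (auto simp: A_def)
    obtain y t where yt: "x2 = F (y, t)"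
      using bijF by (metis bij_pointE surj_pair)
    have x1: "x1 = F (y, t + \<tau>)" using x yt Fsplit[of y "t + \<tau>" t] by simp
    have "F p = F (y, (t + \<tau> + t) / 2)"
      unfolding x(1) x1 yt linear_add[OF linF, symmetric] linear_scale[OF linF, symmetric]
      by (simp add: add_divide_distrib)
    then have "p = (y, (t + \<tau> + t) / 2)" using bijF by (simp add: bij_is_inj inj_eq)
    moreover have "(y, t + \<tau>) \<in> F -` K" "(y, t) \<in> F -` L"
      using x(2,3) x1 yt by simp_all
    ultimately show "p \<in> ?A'" by blast
  qed
  note fib = emeasure_fibre_average[OF comp[OF K(1)] conv[OF K(2)] comp[OF L(1)] conv[OF L(2)] fst,
      folded FA]
  have "A = F ` (F -` A)"
    using bijF by (simp add: bij_is_surj surj_image_vimage_eq)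
  then show A: "compact A"
    using fib(1) compact_continuous_image[OF cont] by metis
  have ennr: "emeasure lborel C = ennreal (measure lborel C)" if "compact C" for C :: "((real \<times> real) \<times> real) set"
    using emeasure_compact_finite[OF that] by (simp add: emeasure_eq_ennreal_measure)
  have "ennreal (2 * measure lborel (F -` A)) = ennreal (measure lborel (F -` K) + measure lborel (F -` L))"
    using fib(2) comp[OF K(1)] comp[OF L(1)] fib(1) by (simp add: ennr ennreal_mult')
  then show "2 * measure lebesgue A = measure lebesgue K + measure lebesgue L"
    unfolding meas[OF A] meas[OF K(1)] meas[OF L(1)] by (subst (asm) ennreal_inj) auto
qed

text \<open>A point of a convex body is a limit of interior points, and the complement of
  \<open>A\<close> is a neighbourhood of \<open>x\<close>. Hence \<open>K\<close> contains a ball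
  disjoint from \<open>A\<close>, whose volume is the gain.\<close>

lemma measure_less_of_compact_subset:
  fixes A K :: "'a::euclidean_space set"
  assumes A: "compact A" "A \<subseteq> K" and K: "compact K" "convex K" "interior K \<noteq> {}"
    and x: "x \<in> K" "x \<notin> A"
  shows "measure lebesgue A < measure lebesgue K"
proof -
  have "x \<in> closure (interior K)"
    using convex_closure_interior[OF K(2,3)] closure_subset x(1) by blast
  moreover have "open (- A)" "x \<in> - A"
    using A x by (auto simp: compact_imp_closed open_Compl)
  ultimately have "interior K \<inter> - A \<noteq> {}"
    by (metis IntI closure_iff_nhds_not_empty interior_subset open_interior order_refl Int_commute)
  moreover have "open (interior K \<inter> - A)"
    using \<open>open (- A)\<close> by (intro open_Int) auto
  ultimately obtain y e where y: "e > 0" "ball y e \<subseteq> interior K \<inter> - A"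
    by (meson equals0I openE)
  have Ball: "ball y e \<in> lmeasurable" "measure lebesgue (ball y e) > 0"
    using content_ball_pos[OF y(1), of y] by (simp_all add: lmeasurable_ball measure_completion)
  have "measure lebesgue A + measure lebesgue (ball y e) = measure lebesgue (A \<union> ball y e)"
    using lmeasurable_compact[OF A(1)] Ball(1) y(2)
    by (intro measure_Union[symmetric]) (auto simp: fmeasurable_def)
  also have "\<dots> \<le> measure lebesgue K"
    using lmeasurable_compact[OF A(1)] lmeasurable_compact[OF K(1)] Ball(1) A(2) y(2) interior_subset[of K]
    by (intro measure_mono_fmeasurable) (auto simp: fmeasurable_def)
  finally show ?thesis using Ball(2) by linarith
qed

lemma unit_vector_with_inner:
  fixes a :: "real^3"
  assumes "norm a = 1" "\<bar>s\<bar> \<le> 1"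
  obtains u where "norm u = 1" "u \<bullet> a = s"
proof -
  have "DIM(real^3) \<ge> 2" by simp
  then obtain b0 where b0: "b0 \<noteq> 0" "orthogonal a b0"
    using orthogonal_to_vector_exists[of a] by auto
  define b where "b = sgn b0"
  have b: "norm b = 1" "a \<bullet> b = 0"
    using b0 by (auto simp: b_def norm_sgn sgn_div_norm orthogonal_def)
  have s: "s\<^sup>2 \<le> 1"
    using assms(2) by (simp add: abs_square_le_1)
  define u where "u = s *\<^sub>R a + sqrt (1 - s\<^sup>2) *\<^sub>R b"
  have aa: "a \<bullet> a = 1" "b \<bullet> b = 1"
    using assms b by (simp_all add: norm_eq_1)
  have "u \<bullet> u = s\<^sup>2 + (sqrt (1 - s\<^sup>2))\<^sup>2"
    using b aa by (simp add: u_def inner_add_left inner_add_right inner_commute power2_eq_square)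
  then have "norm u = 1"
    using s by (simp add: norm_eq_1)
  moreover have "u \<bullet> a = s"
    using b aa by (simp add: u_def inner_add_left inner_commute[of b a])
  ultimately show ?thesis by (rule that)
qed

section \<open>Volume comparison for the two opposite perturbations\<close>

lemma (in perturbable_body) perturbed_average_subset:
  assumes e: "7 * \<bar>\<epsilon>\<bar> \<le> r" "\<bar>\<epsilon>\<bar> \<le> (r * (c - c0)\<^sup>2 / 2)\<^sup>2 / (4 * w)"
    and x: "x \<in> perturbed_body K c a \<epsilon>" and y: "y \<in> perturbed_body K c a (- \<epsilon>)"
  shows "(1/2) *\<^sub>R (x + y) \<in> K"
proof (rule mem_of_support_fun[OF compact_body convex_body nonempty_body])
  fix v :: 'a assume "norm v = 1"
  then have "v \<bullet> x \<le> support_fun K v + \<epsilon> * bump c (v \<bullet> a)" "v \<bullet> y \<le> support_fun K v + - \<epsilon> * bump c (v \<bullet> a)"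
    using x y by (auto simp: perturbed_body_def)
  then show "v \<bullet> (1/2) *\<^sub>R (x + y) \<le> support_fun K v"
    by (simp add: inner_add_right)
qed

text \<open>If the midpoint were \<open>p\<close>, then \<open>x\<close> and \<open>y\<close> would
  have to be the support points of the two bodies at \<open>u\<close>, so \<open>x - y\<close> would
  be \<open>2 \<epsilon>\<close> times \<open>bump_grad c a u\<close>. This vector is a combination
  of \<open>u\<close> and \<open>a\<close> with nonzero coefficient at \<open>u\<close>, hence not
  parallel to \<open>a\<close> as long as \<open>u\<close> is not.\<close>

lemma (in perturbable_body) perturbed_average_misses:
  assumes e: "7 * \<bar>\<epsilon>\<bar> \<le> r" "\<bar>\<epsilon>\<bar> \<le> (r * (c - c0)\<^sup>2 / 2)\<^sup>2 / (4 * w)" and "\<epsilon> \<noteq> 0"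
    and u: "norm u = 1" "c < u \<bullet> a" "u \<bullet> a < 1" and p: "supports K u p"
    and x: "x \<in> perturbed_body K c a \<epsilon>" and y: "y \<in> perturbed_body K c a (- \<epsilon>)"
    and xy: "x = y + \<tau> *\<^sub>R a"
    and P: "constant_width_body (perturbed_body K c a \<epsilon>) w"
    and N: "constant_width_body (perturbed_body K c a (- \<epsilon>)) w"
  shows "(1/2) *\<^sub>R (x + y) \<noteq> p"
proof
  assume eq: "(1/2) *\<^sub>R (x + y) = p"
  have e': "7 * \<bar>- \<epsilon>\<bar> \<le> r" "\<bar>- \<epsilon>\<bar> \<le> (r * (c - c0)\<^sup>2 / 2)\<^sup>2 / (4 * w)"
    using e by simp_all
  let ?P = "perturbed_body K c a \<epsilon>" and ?N = "perturbed_body K c a (- \<epsilon>)"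
  define s where "s = u \<bullet> a"
  have le: "u \<bullet> x \<le> support_fun ?P u" "u \<bullet> y \<le> support_fun ?N u"
    using inner_le_support_fun compact_perturbed_body e e' x y by metis+
  have "u \<bullet> x + u \<bullet> y = 2 * (u \<bullet> p)"
    unfolding eq[symmetric] by (simp add: inner_add_right)
  \<comment> \<open>The two bump terms cancel, so the two inequalities in \<open>le\<close> add up
    to an equality and each of them is sharp.\<close>
  then have "u \<bullet> x + u \<bullet> y = support_fun ?P u + support_fun ?N u"
    using support_fun_perturbed_body(2)[OF e u(1) p] support_fun_perturbed_body(2)[OF e' u(1) p] p
    by (simp add: supports_def)
  with le x y have "supports ?P u x" "supports ?N u y"
    by (auto simp: supports_def)
  then have "x = p + \<epsilon> *\<^sub>R bump_grad c a u" "y = p + (- \<epsilon>) *\<^sub>R bump_grad c a u"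
    using constant_width_body.supports_unique[OF P] constant_width_body.supports_unique[OF N]
      support_fun_perturbed_body(1)[OF e u(1) p]
      support_fun_perturbed_body(1)[OF e' u(1) p] u(1) by metis+
  with xy have "(2 * \<epsilon>) *\<^sub>R bump_grad c a u = \<tau> *\<^sub>R a"
    by (simp add: algebra_simps flip: scaleR_2)
  then have "(1 / (2 * \<epsilon>)) *\<^sub>R (2 * \<epsilon>) *\<^sub>R bump_grad c a u = (1 / (2 * \<epsilon>)) *\<^sub>R \<tau> *\<^sub>R a"
    by simp
  then have g: "bump_grad c a u = (\<tau> / (2 * \<epsilon>)) *\<^sub>R a"
    using \<open>\<epsilon> \<noteq> 0\<close> by simp
  define k m where "k = bump c s - s * bump_deriv c s" and "m = \<tau> / (2 * \<epsilon>) - bump_deriv c s"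
  have km: "k *\<^sub>R u = m *\<^sub>R a"
    using g unfolding bump_grad_def k_def m_def s_def by (simp add: algebra_simps)
  \<comment> \<open>Above \<open>c\<close> the bump is \<open>(s - c)^2\<close>, so the coefficient
    of \<open>u\<close> factors and cannot vanish for \<open>s > c\<close>.\<close>
  have "k = - (s - c) * (s + c)"
    using u c0 unfolding k_def bump_def bump_deriv_def s_def
    by (simp add: max_def power2_eq_square algebra_simps)
  then have "k \<noteq> 0" using u c0 by (simp add: s_def)
  have "k = m * s" "k * s = m"
    using arg_cong[OF km, of "\<lambda>z. z \<bullet> u"] arg_cong[OF km, of "\<lambda>z. z \<bullet> a"] u a
    by (simp_all add: norm_eq_1 s_def inner_commute)
  then have "s * s = 1" using \<open>k \<noteq> 0\<close> by (metis mult.assoc mult_cancel_left1)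
  moreover have "s * s < 1 * 1"
    using u c0 by (intro mult_strict_mono) (auto simp: s_def)
  ultimately show False by simp
qed

lemma (in perturbable_body) constant_width_perturbed_body:
  assumes "7 * \<bar>\<epsilon>\<bar> \<le> r" "\<bar>\<epsilon>\<bar> \<le> (r * (c - c0)\<^sup>2 / 2)\<^sup>2 / (4 * w)"
    and "cball z \<rho> \<subseteq> K" "\<bar>\<epsilon>\<bar> < \<rho>"
  shows "constant_width_body (perturbed_body K c a \<epsilon>) w"
  using w_pos compact_perturbed_body[OF assms(1,2)] convex_perturbed_body[OF assms(1,2)]
    interior_perturbed_body[OF assms] perturbed_body_constant_width[OF assms(1,2)]
  by unfold_locales (auto simp: convex_body_def)

text \<open>The two perturbations average to \<open>K\<close>, and their fibrewise average in the direction \<open>a\<close> has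
  the mean volume but misses boundary points of \<open>K\<close>.  So \<open>K\<close> has more than the mean volume.\<close>

theorem perturbable_not_local_minimizer:
  fixes K :: "(real^3) set"
  assumes "perturbable_body K w a c0 c r" and c: "c < 1"
  shows "\<not> local_minimizer w K"
proof
  interpret perturbable_body K w a c0 c r by fact
  assume "local_minimizer w K"
  then obtain \<delta> where "\<delta> > 0" and min: "\<And>B'. convex_body B' \<Longrightarrow> has_constant_width B' (2 * w) \<Longrightarrow>
      hausdorff_distance K B' < \<delta> \<Longrightarrow> volume_ratio w K \<le> volume_ratio w B'"
    using w_pos unfolding local_minimizer_def by blast
  obtain z \<rho> where z: "\<rho> > 0" "cball z \<rho> \<subseteq> K"
    using interior_body by (auto simp: mem_interior_cball)
  define q where "q = (r * (c - c0)\<^sup>2 / 2)\<^sup>2 / (4 * w)"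
  have "q > 0" unfolding q_def using r c0 w_pos by simp
  \<comment> \<open>The bounds \<open>r / 7\<close> and \<open>q\<close> make the Wulff shapes have
    the prescribed support functions, \<open>\<delta> / 2\<close> keeps both within the
    neighbourhood of minimality, and \<open>\<rho> / 2\<close> preserves an interior ball.\<close>
  define \<epsilon> where "\<epsilon> = Min {r / 7, q, \<delta> / 2, \<rho> / 2}"
  have "\<epsilon> \<le> r / 7" "\<epsilon> \<le> q" "\<epsilon> \<le> \<delta> / 2" "\<epsilon> \<le> \<rho> / 2"
    unfolding \<epsilon>_def by (intro Min_le; simp)+
  moreover have "\<epsilon> > 0"
    unfolding \<epsilon>_def using r \<open>q > 0\<close> \<open>\<delta> > 0\<close> z by (subst Min_gr_iff) auto
  ultimately have e: "7 * \<bar>\<epsilon>\<bar> \<le> r" "\<bar>\<epsilon>\<bar> \<le> (r * (c - c0)\<^sup>2 / 2)\<^sup>2 / (4 * w)" "\<bar>\<epsilon>\<bar> < \<rho>" "\<bar>\<epsilon>\<bar> < \<delta>" "\<epsilon> \<noteq> 0"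
    using z \<open>\<delta> > 0\<close> unfolding q_def by auto
  then have e': "7 * \<bar>- \<epsilon>\<bar> \<le> r" "\<bar>- \<epsilon>\<bar> \<le> (r * (c - c0)\<^sup>2 / 2)\<^sup>2 / (4 * w)" "\<bar>- \<epsilon>\<bar> < \<rho>" "\<bar>- \<epsilon>\<bar> < \<delta>"
    by simp_all
  define P where "P = perturbed_body K c a \<epsilon>"
  define N where "N = perturbed_body K c a (- \<epsilon>)"
  interpret P: constant_width_body P w
    unfolding P_def by (rule constant_width_perturbed_body[OF e(1,2) z(2) e(3)])
  interpret N: constant_width_body N w
    unfolding N_def by (rule constant_width_perturbed_body[OF e'(1,2) z(2) e'(3)])
  have ratio: "measure lebesgue K \<le> measure lebesgue B'" if "volume_ratio w K \<le> volume_ratio w B'" for B'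
    using that w_pos unfolding volume_ratio_def by (simp add: divide_le_cancel)
  have KP: "measure lebesgue K \<le> measure lebesgue P"
    using hausdorff_distance_perturbed_body[OF e(1,2)] e(4)
    by (intro ratio min P.body P.width) (simp add: P_def)
  have KN: "measure lebesgue K \<le> measure lebesgue N"
    using hausdorff_distance_perturbed_body[OF e'(1,2)] e'(4)
    by (intro ratio min N.body N.width) (simp add: N_def)
  have eq: "support_fun P v = support_fun N v" if v: "norm v = 1" "v \<bullet> a = 0" for v
  proof -
    obtain x where x: "supports K v x"
      using supports_exists compact_body nonempty_body by blast
    show ?thesis
      unfolding P_def N_def support_fun_perturbed_body(2)[OF e(1,2) v(1) x]
        support_fun_perturbed_body(2)[OF e'(1,2) v(1) x]
      using v c0 by (simp add: bump_eq_0)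
  qed
  define A where "A = {(1/2) *\<^sub>R (x + y) | x y. x \<in> P \<and> y \<in> N \<and> (\<exists>\<tau>. x = y + \<tau> *\<^sub>R a)}"
  have lines: "\<exists>\<tau>. x + \<tau> *\<^sub>R a \<in> N" if "x \<in> P" for x
    using line_meets_of_support_fun_le[OF P.compact_body N.compact_body N.convex_body N.nonempty_body _ that]
      eq by simp
  have lines': "\<exists>\<tau>. x + \<tau> *\<^sub>R a \<in> P" if "x \<in> N" for x
    using line_meets_of_support_fun_le[OF N.compact_body P.compact_body P.convex_body P.nonempty_body _ that]
      eq by simp
  have A: "compact A" "2 * measure lebesgue A = measure lebesgue P + measure lebesgue N"
    unfolding A_def
    using measure_line_average[OF P.compact_body P.convex_body N.compact_body N.convex_body a lines lines']
    by auto
  \<comment> \<open>Any direction with \<open>c < u \<bullet> a < 1\<close> would serve: the bump is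
    active there, and \<open>u\<close> is not parallel to \<open>a\<close>.\<close>
  obtain u where u: "norm u = 1" "u \<bullet> a = (c + 1) / 2"
    using unit_vector_with_inner[OF a, of "(c + 1) / 2"] c0 c by auto
  obtain p where p: "supports K u p"
    using supports_exists compact_body nonempty_body by blast
  have "p \<notin> A"
    using perturbed_average_misses[OF e(1,2,5) u(1) _ _ p, folded P_def N_def] u c
      P.constant_width_body_axioms N.constant_width_body_axioms
    unfolding A_def by fastforce
  moreover have "A \<subseteq> K"
    unfolding A_def P_def N_def using perturbed_average_subset[OF e(1,2)] by blast
  ultimately have "measure lebesgue A < measure lebesgue K"
    using p by (intro measure_less_of_compact_subset[OF A(1) _ compact_body convex_body interior_body, of p])
      (auto simp: supports_def)
  then show False
    using A(2) KP KN by simp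
qed

section \<open>Interior balls at nondegenerate boundary points\<close>

context constant_width_body
begin

text \<open>Being a support point is expressed by the closed conditions
  \<open>v \<bullet> z \<le> v \<bullet> y\<close> for all \<open>z\<close> in \<open>K\<close>.
  Compactness provides a positive minimum for normals that stay away from \<open>a\<close>.\<close>

lemma compact_support_pairs: "compact {(v, y). norm v = 1 \<and> supports K v y \<and> \<eta> \<le> norm (v - a)}"
proof -
  have "{(v, y). norm v = 1 \<and> supports K v y \<and> \<eta> \<le> norm (v - a)} =
    (sphere 0 1 \<times> K) \<inter> ((\<Inter>z\<in>K. {q. fst q \<bullet> z \<le> fst q \<bullet> snd q}) \<inter> {q. \<eta> \<le> norm (fst q - a)})"
    (is "?L = ?R")
  proof (intro equalityI subsetI)
    fix q assume "q \<in> ?L"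
    then show "q \<in> ?R"
      using inner_le_support_fun[OF compact_body] by (auto simp: supports_def)
  next
    fix q assume "q \<in> ?R"
    then show "q \<in> ?L"
      using supportsI[OF compact_body] by (auto split: prod.splits)
  qed
  also have "compact \<dots>"
    by (intro compact_Int_closed compact_Times compact_body closed_Int closed_INT ballI
        closed_Collect_le continuous_intros) auto
  finally show ?thesis .
qed

text \<open>If \<open>x\<^sub>v - x\<^sub>a = 2w (v - a)\<close>, then \<open>x\<^sub>-\<^sub>a = x\<^sub>-\<^sub>v\<close>, and \<open>\<partial>K\<close> contains the circular arc of radius
  \<open>2w\<close> around this vertex from \<open>x\<^sub>a\<close> to \<open>x\<^sub>v\<close>, which the second estimate forbids near \<open>x\<^sub>a\<close>.\<close>

lemma no_arc_at_nondegenerate_point: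
  assumes a: "norm a = 1" and p: "supports K a p" and v: "norm v = 1" and y: "supports K v y"
    and "v \<noteq> a" and eq: "y - p = (2 * w) *\<^sub>R (v - a)" and d: "\<delta> > 0"
    and loc: "\<And>u x. norm u = 1 \<Longrightarrow> supports K u x \<Longrightarrow> norm (x - p) < \<delta> \<Longrightarrow>
      norm (u - a) \<le> C * norm ((x - p) - (2 * w) *\<^sub>R (u - a))"
  shows False
proof -
  \<comment> \<open>The opposite direction is impossible, as the displacement would have length
    \<open>4 * w\<close>, twice the diameter bound.\<close>
  have va: "v \<noteq> - a"
  proof
    assume "v = - a"
    then have "y - p = - ((4 * w) *\<^sub>R a)" using eq by (simp flip: scaleR_2 add: algebra_simps)
    then have "norm (y - p) = 4 * w"
      using a w_pos by simp
    then show False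
      using diameter_le[of y p] y p w_pos by (simp add: supports_def)
  qed
  \<comment> \<open>The normalised direction \<open>m\<close> lies within \<open>4 * t\<close> of
    \<open>a\<close>, so its support point moves by at most \<open>8 * w * t\<close>, which is at
    most half of \<open>\<delta>\<close>; \<open>t \<le> 1 / 4\<close> keeps \<open>z\<close> away
    from 0.\<close>
  define t where "t = min (1 / 4) (\<delta> / (16 * w))"
  have t: "0 < t" "t \<le> 1 / 4" "t \<le> \<delta> / (16 * w)"
    using d w_pos by (auto simp: t_def)
  define z where "z = a + t *\<^sub>R (v - a)"
  have "norm (v - a) \<le> 2"
    using norm_triangle_ineq4[of v a] a v by simp
  then have za: "norm (z - a) \<le> 2 * t"
    using t by (simp add: z_def)
  have nz: "\<bar>norm z - 1\<bar> \<le> 2 * t"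
    using norm_triangle_ineq3[of z a] za a by simp
  then have "z \<noteq> 0" using t by auto
  define m where "m = sgn z"
  have m: "norm m = 1"
    using \<open>z \<noteq> 0\<close> by (simp add: m_def norm_sgn)
  have zm: "z = norm z *\<^sub>R m"
    using \<open>z \<noteq> 0\<close> by (simp add: m_def sgn_div_norm)
  have "norm (m - a) \<le> norm (m - z) + norm (z - a)"
    using norm_triangle_ineq[of "m - z" "z - a"] by simp
  also have "m - z = (1 - norm z) *\<^sub>R m"
    by (subst (1) zm) (simp add: algebra_simps)
  also have "norm \<dots> = \<bar>norm z - 1\<bar>"
    using m by simp
  finally have ma: "norm (m - a) \<le> 4 * t"
    using nz za by linarith
  define q where "q = p - (2 * w) *\<^sub>R a"
  have "q = y - (2 * w) *\<^sub>R v"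
    using eq by (simp add: q_def algebra_simps)
  then have q: "supports K (- a) q" "supports K (- v) q"
    using supports_opposite[OF a p] supports_opposite[OF v y] by (simp_all add: q_def)
  \<comment> \<open>Outer normals at the common opposite point \<open>q\<close> form a convex cone,
    and \<open>m\<close> is a positive multiple of a convex combination of \<open>a\<close> and
    \<open>v\<close>.\<close>
  have "supports K (- m) q"
  proof (rule supportsI[OF compact_body])
    show "q \<in> K" using q by (simp add: supports_def)
    fix x assume x: "x \<in> K"
    have ax: "a \<bullet> q \<le> a \<bullet> x" "v \<bullet> q \<le> v \<bullet> x"
      using q inner_le_support_fun[OF compact_body x, of "- a"]
        inner_le_support_fun[OF compact_body x, of "- v"] by (auto simp: supports_def)
    have "(1 - t) * (a \<bullet> q) + t * (v \<bullet> q) \<le> (1 - t) * (a \<bullet> x) + t * (v \<bullet> x)"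
      using ax t by (intro add_mono mult_left_mono) auto
    then have "z \<bullet> q \<le> z \<bullet> x"
      by (simp add: z_def inner_add_left inner_diff_left algebra_simps)
    then have "m \<bullet> q \<le> m \<bullet> x"
      using \<open>z \<noteq> 0\<close> by (simp add: m_def sgn_div_norm divide_right_mono)
    then show "- m \<bullet> x \<le> - m \<bullet> q" by simp
  qed
  then have "supports K m (q + (2 * w) *\<^sub>R m)"
    using supports_opposite[of "- m" q] m by simp
  moreover have qp: "q + (2 * w) *\<^sub>R m - p = (2 * w) *\<^sub>R (m - a)"
    by (simp add: q_def algebra_simps)
  moreover have "norm ((2 * w) *\<^sub>R (m - a)) < \<delta>"
  proof -
    have "norm ((2 * w) *\<^sub>R (m - a)) \<le> 2 * w * (4 * t)"
      using ma w_pos by simp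
    also have "\<dots> \<le> 2 * w * (4 * (\<delta> / (16 * w)))"
      using t w_pos by (intro mult_left_mono) auto
    also have "\<dots> < \<delta>" using w_pos d by simp
    finally show ?thesis .
  qed
  \<comment> \<open>For the pair of \<open>m\<close> and its support point the right side of
    \<open>loc\<close> is zero. So \<open>m = a\<close>, which would make \<open>v\<close> collinear
    with \<open>a\<close>.\<close>
  ultimately have "norm (m - a) \<le> 0"
    using loc[OF m, of "q + (2 * w) *\<^sub>R m"] by simp
  then have "t *\<^sub>R v = (norm z - 1 + t) *\<^sub>R a"
    using zm by (simp add: z_def algebra_simps)
  then have "(1 / t) *\<^sub>R t *\<^sub>R v = (1 / t) *\<^sub>R (norm z - 1 + t) *\<^sub>R a"
    by simp
  then have vk: "v = ((norm z - 1 + t) / t) *\<^sub>R a"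
    using t by simp
  then have "\<bar>(norm z - 1 + t) / t\<bar> = 1"
    using a v by (metis mult.right_neutral norm_scaleR)
  then have "(norm z - 1 + t) / t = 1 \<or> (norm z - 1 + t) / t = - 1"
    by linarith
  then show False
    using vk va \<open>v \<noteq> a\<close> by (metis scaleR_minus1_left scaleR_one)
qed

text \<open>Only \<open>u\<close> stays near \<open>a\<close>, whereas \<open>v\<close> becomes
  arbitrary. For \<open>v\<close> far from \<open>a\<close>, neither \<open>y - p\<close> nor
  \<open>(y - p) - 2w (v - a)\<close> can vanish: the former would put two normals at
  \<open>p\<close>, the latter is the excluded arc. Compactness bounds both away from 0, and
  \<open>norm (u - v) \<le> 2\<close> does the rest. The second estimate is the first one for the
  opposite support points.\<close>

lemma normal_difference_le:
  assumes a: "norm a = 1" and p: "supports K a p" and d: "\<delta> > 0"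
    and loc1: "\<And>u x v y. norm u = 1 \<Longrightarrow> supports K u x \<Longrightarrow> norm (x - p) < \<delta> \<Longrightarrow>
      norm v = 1 \<Longrightarrow> supports K v y \<Longrightarrow> norm (y - p) < \<delta> \<Longrightarrow> norm (u - v) \<le> C * norm (x - y)"
    and loc2: "\<And>u x v y. norm u = 1 \<Longrightarrow> supports K u x \<Longrightarrow> norm (x - p) < \<delta> \<Longrightarrow>
      norm v = 1 \<Longrightarrow> supports K v y \<Longrightarrow> norm (y - p) < \<delta> \<Longrightarrow>
      norm (u - v) \<le> C * norm ((x - y) - (2 * w) *\<^sub>R (u - v))"
  obtains \<eta> D where "\<eta> > 0" "D > 0"
    "\<And>u x v y. norm u = 1 \<Longrightarrow> supports K u x \<Longrightarrow> norm (u - a) < \<eta> \<Longrightarrow> norm v = 1 \<Longrightarrow> supports K v y \<Longrightarrow>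
      norm (u - v) \<le> D * norm (x - y) \<and> norm (u - v) \<le> D * norm ((x - y) - (2 * w) *\<^sub>R (u - v))"
proof -
  \<comment> \<open>Support points depend on the normal with Lipschitz constant
    \<open>2 * w\<close>, so such normals have support points within \<open>\<delta> / 2\<close> of
    \<open>p\<close>.\<close>
  define \<eta>1 where "\<eta>1 = \<delta> / (4 * w)"
  have "\<eta>1 > 0" using d w_pos by (simp add: \<eta>1_def)
  have near: "norm (x - p) < \<delta>" if "norm u = 1" "supports K u x" "norm (u - a) < \<eta>1" for u x
  proof -
    have "norm (x - p) \<le> 2 * w * norm (u - a)"
      by (rule supports_lipschitz[OF that(1) a that(2) p])
    also have "\<dots> \<le> 2 * w * \<eta>1"
      using that w_pos by (intro mult_left_mono) auto
    also have "\<dots> < \<delta>" using w_pos d by (simp add: \<eta>1_def)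
    finally show ?thesis .
  qed
  define T where "T = {(v, y). norm v = 1 \<and> supports K v y \<and> \<eta>1 \<le> norm (v - a)}"
  define f where "f = (\<lambda>q. min (norm (snd q - p)) (norm ((snd q - p) - (2 * w) *\<^sub>R (fst q - a))))"
  have f_pos: "f q > 0" if "q \<in> T" for q
  proof -
    obtain v y where q: "q = (v, y)" by force
    with that have v: "norm v = 1" "supports K v y" "v \<noteq> a"
      using \<open>\<eta>1 > 0\<close> by (auto simp: T_def)
    have "y \<noteq> p"
      using loc1[OF v(1,2) _ a p] v d by auto
    moreover have "y - p \<noteq> (2 * w) *\<^sub>R (v - a)"
      using no_arc_at_nondegenerate_point[OF a p v _ d, of C] loc2[OF _ _ _ a p] d by auto
    ultimately show ?thesis
      using q by (simp add: f_def)
  qed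
  obtain \<mu> where \<mu>: "\<mu> > 0" "\<And>q. q \<in> T \<Longrightarrow> \<mu> \<le> f q"
  proof (cases "T = {}")
    case True
    then show thesis using that[of 1] by simp
  next
    case False
    have "compact T"
      unfolding T_def by (rule compact_support_pairs)
    moreover have "continuous_on T f"
      unfolding f_def by (intro continuous_intros)
    ultimately obtain q0 where "q0 \<in> T" "\<forall>q\<in>T. f q0 \<le> f q"
      using continuous_attains_inf[of T f] False by blast
    then show thesis
      using that[of "f q0"] f_pos by blast
  qed
  \<comment> \<open>Replacing \<open>a\<close> by \<open>u\<close> changes each of \<open>p\<close>
    and \<open>2w a\<close> by at most \<open>\<mu> / 4\<close>, so at least
    \<open>\<mu> / 2\<close> of the lower bound survives. The value \<open>4 / \<mu>\<close> in
    \<open>D\<close> then covers the trivial bound 2.\<close>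
  define \<eta> where "\<eta> = min \<eta>1 (\<mu> / (8 * w))"
  define D where "D = max C (4 / \<mu>)"
  have D: "D \<ge> 4 / \<mu>" "D \<ge> C" "D > 0"
    using \<mu>(1) by (auto simp: D_def less_max_iff_disj)
  show thesis
  proof (rule that[of \<eta> D])
    show "\<eta> > 0" using \<open>\<eta>1 > 0\<close> \<mu>(1) w_pos by (simp add: \<eta>_def)
    show "D > 0" by fact
    fix u x v y
    assume u: "norm u = 1" "supports K u x" and ua: "norm (u - a) < \<eta>" and v: "norm v = 1" "supports K v y"
    have xp: "norm (x - p) < \<delta>"
      using near[OF u] ua by (simp add: \<eta>_def)
    show "norm (u - v) \<le> D * norm (x - y) \<and> norm (u - v) \<le> D * norm ((x - y) - (2 * w) *\<^sub>R (u - v))"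
    proof (cases "norm (v - a) < \<eta>1")
      case True
      then have yp: "norm (y - p) < \<delta>"
        by (rule near[OF v])
      have "C * norm (x - y) \<le> D * norm (x - y)"
        "C * norm ((x - y) - (2 * w) *\<^sub>R (u - v)) \<le> D * norm ((x - y) - (2 * w) *\<^sub>R (u - v))"
        using D by (auto intro!: mult_right_mono)
      then show ?thesis
        using loc1[OF u xp v yp] loc2[OF u xp v yp] by linarith
    next
      case False
      then have "(v, y) \<in> T" using v by (simp add: T_def)
      then have \<mu>_le: "\<mu> \<le> norm (y - p)" "\<mu> \<le> norm ((y - p) - (2 * w) *\<^sub>R (v - a))"
        using \<mu>(2)[of "(v, y)"] by (auto simp: f_def)
      have ua': "2 * w * norm (u - a) \<le> \<mu> / 4"
      proof -
        have "2 * w * norm (u - a) \<le> 2 * w * (\<mu> / (8 * w))"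
          using ua w_pos by (intro mult_left_mono) (auto simp: \<eta>_def)
        also have "\<dots> = \<mu> / 4" using w_pos by simp
        finally show ?thesis .
      qed
      then have xp': "norm (x - p) \<le> \<mu> / 4"
        using supports_lipschitz[OF u(1) a u(2) p] by linarith
      have 1: "\<mu> / 2 \<le> norm (x - y)"
        using norm_triangle_ineq[of "y - x" "x - p"] \<mu>_le(1) xp' \<mu>(1)
        by (simp add: norm_minus_commute)
      have tri: "norm (- X + Y) \<le> norm X + norm Y" for X Y :: 'a
        using norm_triangle_ineq[of "- X" Y] by simp
      have "(y - p) - (2 * w) *\<^sub>R (v - a) =
        - ((x - y) - (2 * w) *\<^sub>R (u - v)) + ((x - p) - (2 * w) *\<^sub>R (u - a))"
        by (simp add: algebra_simps)
      then have "\<mu> \<le> norm ((x - y) - (2 * w) *\<^sub>R (u - v)) + norm ((x - p) - (2 * w) *\<^sub>R (u - a))"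
        using \<mu>_le(2) tri order_trans by metis
      moreover have "norm ((x - p) - (2 * w) *\<^sub>R (u - a)) \<le> \<mu> / 4 + \<mu> / 4"
        using norm_triangle_ineq4[of "x - p" "(2 * w) *\<^sub>R (u - a)"] xp' ua' w_pos by simp
      ultimately have 2: "\<mu> / 2 \<le> norm ((x - y) - (2 * w) *\<^sub>R (u - v))"
        by linarith
      have "norm (u - v) \<le> 2"
        using norm_triangle_ineq4[of u v] u v by simp
      also have "2 = 4 / \<mu> * (\<mu> / 2)" using \<mu>(1) by simp
      finally have 3: "norm (u - v) \<le> 4 / \<mu> * (\<mu> / 2)" .
      have "4 / \<mu> * (\<mu> / 2) \<le> D * norm (x - y)"
        "4 / \<mu> * (\<mu> / 2) \<le> D * norm ((x - y) - (2 * w) *\<^sub>R (u - v))"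
        using D(3) \<mu>(1) by (auto intro!: mult_mono D(1) 1 2 simp del: times_divide_eq_left times_divide_eq_right)
      then show ?thesis using 3 by linarith
    qed
  qed
qed

text \<open>Lipschitz normals produce interior balls: \<open>2 * (1 - u \<bullet> v)\<close> is the
  squared distance of the normals, at most \<open>D^2\<close> times that of the support points, and
  the exterior ball bounds the latter by \<open>4 * w\<close> times the support gap. This gives the
  radius \<open>r\<close>.\<close>

lemma perturbable_of_normal_difference_le:
  assumes a: "norm a = 1" and "\<eta> > 0" "D > 0"
    and le: "\<And>u x v y. norm u = 1 \<Longrightarrow> supports K u x \<Longrightarrow> norm (u - a) < \<eta> \<Longrightarrow> norm v = 1 \<Longrightarrow> supports K v y \<Longrightarrow>
      norm (u - v) \<le> D * norm (x - y) \<and> norm (u - v) \<le> D * norm ((x - y) - (2 * w) *\<^sub>R (u - v))"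
  shows "\<exists>c0 c r. perturbable_body K w a c0 c r \<and> c < 1"
proof -
  \<comment> \<open>For unit vectors the squared distance is \<open>2 * (1 - u \<bullet> a)\<close>,
    so \<open>u \<bullet> a > c0\<close> places \<open>u\<close> within \<open>\<eta>\<close> of
    \<open>a\<close>.\<close>
  define c0 where "c0 = max 0 (1 - \<eta>\<^sup>2 / 2)"
  define r where "r = 1 / (2 * w * D\<^sup>2)"
  have c0: "0 \<le> c0" "c0 < 1" and r: "r > 0"
    using \<open>\<eta> > 0\<close> \<open>D > 0\<close> w_pos by (auto simp: c0_def r_def)
  have near: "norm (u - a) < \<eta>" if "norm u = 1" "u \<bullet> a > c0" for u
  proof -
    have "(norm (u - a))\<^sup>2 < \<eta>\<^sup>2"
      using norm_diff_unit[OF that(1) a] that(2) by (simp add: c0_def)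
    then show ?thesis
      using \<open>\<eta> > 0\<close> by (simp add: power_less_imp_less_base)
  qed
  have "perturbable_body K w a c0 ((1 + c0) / 2) r"
  proof unfold_locales
    fix u x v :: 'a assume u: "norm u = 1" and v: "norm v = 1" and ua: "c0 < \<bar>u \<bullet> a\<bar>" and x: "supports K u x"
    obtain y where y: "supports K v y"
      using supports_exists compact_body nonempty_body by blast
    have "norm (u - v) \<le> D * norm (x - y)"
    proof (cases "u \<bullet> a > c0")
      case True
      then show ?thesis using le[OF u x near[OF u] v y] by blast
    next
      case False
      then have ma: "(- u) \<bullet> a > c0" using ua by simp
      have u': "norm (- u) = 1" and v': "norm (- v) = 1" using u v by simp_all
      \<comment> \<open>On the opposite cap the second estimate is applied to the antipodal normals
        and points; the correction by \<open>2 * w\<close> recovers exactly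
        \<open>x - y\<close>.\<close>
      have "norm (- u - - v) \<le> D * norm ((x - (2 * w) *\<^sub>R u - (y - (2 * w) *\<^sub>R v)) - (2 * w) *\<^sub>R (- u - - v))"
        using le[OF u' supports_opposite[OF u x] near[OF u' ma] v' supports_opposite[OF v y]] by blast
      also have "(x - (2 * w) *\<^sub>R u - (y - (2 * w) *\<^sub>R v)) - (2 * w) *\<^sub>R (- u - - v) = x - y"
        by (simp add: algebra_simps)
      finally have "norm (- u - - v) \<le> D * norm (x - y)" .
      then show ?thesis
        by (simp add: norm_minus_commute)
    qed
    then have "(norm (u - v))\<^sup>2 \<le> (D * norm (x - y))\<^sup>2"
      by (intro power_mono) auto
    then have "2 * (1 - u \<bullet> v) \<le> D\<^sup>2 * (norm (x - y))\<^sup>2"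
      using norm_diff_unit[OF u v] by (simp add: power_mult_distrib)
    also have "\<dots> \<le> D\<^sup>2 * (4 * w * (v \<bullet> (y - x)))"
      using x by (intro mult_left_mono exterior_ball v y) (auto simp: supports_def)
    also have "v \<bullet> (y - x) = support_fun K v - v \<bullet> x"
      using y by (simp add: supports_def inner_diff_right)
    finally show "r * (1 - u \<bullet> v) \<le> support_fun K v - v \<bullet> x"
      using w_pos \<open>D > 0\<close> by (simp add: r_def field_simps)
  qed (use a c0 r in auto)
  then show ?thesis
    using c0 by (intro exI[of _ c0] exI[of _ "(1 + c0) / 2"] exI[of _ r]) auto
qed

end

section \<open>Strict derivatives\<close>

text \<open>Strict differentiability compares two moving points near \<open>x0\<close>, as the
  Lipschitz estimates for normals require; an ordinary derivative controls only differences from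
  \<open>x0\<close>.\<close>

definition has_strict_derivative ::
    "('a::real_normed_vector \<Rightarrow> 'b::real_normed_vector) \<Rightarrow> ('a \<Rightarrow> 'b) \<Rightarrow> 'a \<Rightarrow> bool" where
  "has_strict_derivative f D x0 \<longleftrightarrow> bounded_linear D \<and>
     (\<forall>e>0. \<exists>d>0. \<forall>x\<in>ball x0 d. \<forall>y\<in>ball x0 d. norm (f x - f y - D (x - y)) \<le> e * norm (x - y))"

lemma has_strict_derivativeD:
  assumes "has_strict_derivative f D x0" "e > 0"
  obtains d where "d > 0"
    "\<And>x y. x \<in> ball x0 d \<Longrightarrow> y \<in> ball x0 d \<Longrightarrow> norm (f x - f y - D (x - y)) \<le> e * norm (x - y)"
  using assms unfolding has_strict_derivative_def by blast

lemma has_strict_derivative_imp_bounded_linear: "has_strict_derivative f D x0 \<Longrightarrow> bounded_linear D"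
  by (simp add: has_strict_derivative_def)

text \<open>Continuity on the finitely many basis vectors makes \<open>D x\<close> close to
  \<open>D x0\<close> in operator norm, and the mean value inequality on a segment finishes. The
  tolerance is divided by the dimension because the basis errors add up.\<close>

lemma has_strict_derivative_of_continuous:
  fixes f :: "'a::euclidean_space \<Rightarrow> 'b::real_normed_vector"
  assumes U: "open U" "x0 \<in> U"
    and f: "\<And>x. x \<in> U \<Longrightarrow> (f has_derivative D x) (at x)"
    and D: "\<And>i. i \<in> Basis \<Longrightarrow> continuous (at x0) (\<lambda>x. D x i)"
  shows "has_strict_derivative f (D x0) x0"
  unfolding has_strict_derivative_def
proof (intro conjI allI impI)
  show "bounded_linear (D x0)"
    using f[OF U(2)] by (rule has_derivative_bounded_linear)
  fix e :: real assume "e > 0"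
  define e' where "e' = e / DIM('a)"
  have "e' > 0" using \<open>e > 0\<close> by (simp add: e'_def)
  have "\<forall>\<^sub>F x in at x0. \<forall>i\<in>Basis. dist (D x i) (D x0 i) < e'"
  proof (rule eventually_ball_finite)
    show "\<forall>i\<in>Basis. \<forall>\<^sub>F x in at x0. dist (D x i) (D x0 i) < e'"
      using D \<open>e' > 0\<close> by (auto simp: continuous_at intro!: tendstoD)
  qed simp
  then obtain d1 where d1: "d1 > 0" "\<And>x i. x \<noteq> x0 \<Longrightarrow> dist x x0 < d1 \<Longrightarrow> i \<in> Basis \<Longrightarrow> dist (D x i) (D x0 i) < e'"
    unfolding eventually_at by blast
  obtain d2 where d2: "d2 > 0" "ball x0 d2 \<subseteq> U"
    using U by (meson openE)
  define d where "d = min d1 d2"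
  have "d > 0" and dU: "ball x0 d \<subseteq> U" and dd: "d \<le> d1"
    using d1 d2 by (auto simp: d_def)
  have close: "norm (D x i - D x0 i) \<le> e'" if "x \<in> ball x0 d" "i \<in> Basis" for x i
    using d1(2)[of x i] that \<open>e' > 0\<close> dd by (cases "x = x0") (auto simp: dist_norm norm_minus_commute)
  have onorm: "onorm (D x - D x0) \<le> e" if x: "x \<in> ball x0 d" for x
  proof (rule onorm_le)
    fix h :: 'a
    have lin: "linear (D x)" "linear (D x0)"
      using f x dU U(2) has_derivative_linear by blast+
    have "(D x - D x0) h = D x (\<Sum>i\<in>Basis. (h \<bullet> i) *\<^sub>R i) - D x0 (\<Sum>i\<in>Basis. (h \<bullet> i) *\<^sub>R i)"
      by (simp add: euclidean_representation)
    also have "\<dots> = (\<Sum>i\<in>Basis. (h \<bullet> i) *\<^sub>R (D x i - D x0 i))"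
      by (simp add: linear_sum[OF lin(1)] linear_sum[OF lin(2)] linear_scale[OF lin(1)] linear_scale[OF lin(2)]
          scaleR_diff_right sum_subtractf)
    also have "norm \<dots> \<le> (\<Sum>i\<in>(Basis::'a set). norm h * e')"
      using close[OF x] by (intro sum_norm_le) (auto intro!: mult_mono Basis_le_norm)
    also have "\<dots> = e * norm h"
      by (simp add: e'_def)
    finally show "norm ((D x - D x0) h) \<le> e * norm h" .
  qed
  show "\<exists>d>0. \<forall>x\<in>ball x0 d. \<forall>y\<in>ball x0 d. norm (f x - f y - D x0 (x - y)) \<le> e * norm (x - y)"
  proof (intro exI[of _ d] conjI ballI \<open>d > 0\<close>)
    fix x y assume xy: "x \<in> ball x0 d" "y \<in> ball x0 d"
    have "norm (f x - f y - D x0 (x - y)) \<le> norm (x - y) * e"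
    proof (rule differentiable_bound_linearization[where S = "ball x0 d" and f' = D])
      fix t :: real assume "t \<in> {0..1}"
      then have "(1 - t) *\<^sub>R y + t *\<^sub>R x \<in> ball x0 d"
        using xy convexD_alt[OF convex_ball, of y x0 d x t] by auto
      then show "y + t *\<^sub>R (x - y) \<in> ball x0 d"
        by (simp add: algebra_simps)
    next
      fix z assume "z \<in> ball x0 d"
      then show "(f has_derivative D z) (at z within ball x0 d)"
        using f dU has_derivative_at_withinI by blast
    qed (use onorm \<open>d > 0\<close> in auto)
    then show "norm (f x - f y - D x0 (x - y)) \<le> e * norm (x - y)"
      by (simp add: mult.commute)
  qed
qed

lemma has_strict_derivative_imp_has_derivative:
  assumes "has_strict_derivative f D x0"
  shows "(f has_derivative D) (at x0)"
  unfolding has_derivative_at_alt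
proof (intro conjI allI impI)
  show "bounded_linear D" using assms by (rule has_strict_derivative_imp_bounded_linear)
  fix e :: real assume "e > 0"
  then obtain d where "d > 0"
    "\<And>x y. x \<in> ball x0 d \<Longrightarrow> y \<in> ball x0 d \<Longrightarrow> norm (f x - f y - D (x - y)) \<le> e * norm (x - y)"
    using has_strict_derivativeD[OF assms] by blast
  then show "\<exists>d>0. \<forall>y. norm (y - x0) < d \<longrightarrow> norm (f y - f x0 - D (y - x0)) \<le> e * norm (y - x0)"
    by (intro exI[of _ d]) (auto simp: dist_norm norm_minus_commute)
qed

lemma has_strict_derivative_diff_scaleR:
  assumes f: "has_strict_derivative f Df x0" and g: "has_strict_derivative g Dg x0"
  shows "has_strict_derivative (\<lambda>x. f x - c *\<^sub>R g x) (\<lambda>h. Df h - c *\<^sub>R Dg h) x0"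
  unfolding has_strict_derivative_def
proof (intro conjI allI impI)
  show "bounded_linear (\<lambda>h. Df h - c *\<^sub>R Dg h)"
    using assms by (intro bounded_linear_sub bounded_linear_const_scaleR has_strict_derivative_imp_bounded_linear)
  fix e :: real assume e: "e > 0"
  define e' where "e' = e / (2 * (\<bar>c\<bar> + 1))"
  have e': "e' > 0" using e by (simp add: e'_def)
  obtain d1 where d1: "d1 > 0"
    "\<And>x y. x \<in> ball x0 d1 \<Longrightarrow> y \<in> ball x0 d1 \<Longrightarrow> norm (f x - f y - Df (x - y)) \<le> e / 2 * norm (x - y)"
    using has_strict_derivativeD[OF f, of "e / 2"] e by auto
  obtain d2 where d2: "d2 > 0"
    "\<And>x y. x \<in> ball x0 d2 \<Longrightarrow> y \<in> ball x0 d2 \<Longrightarrow> norm (g x - g y - Dg (x - y)) \<le> e' * norm (x - y)"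
    using has_strict_derivativeD[OF g e'] by blast
  show "\<exists>d>0. \<forall>x\<in>ball x0 d. \<forall>y\<in>ball x0 d.
    norm (f x - c *\<^sub>R g x - (f y - c *\<^sub>R g y) - (Df (x - y) - c *\<^sub>R Dg (x - y))) \<le> e * norm (x - y)"
  proof (intro exI[of _ "min d1 d2"] conjI ballI)
    fix x y assume xy: "x \<in> ball x0 (min d1 d2)" "y \<in> ball x0 (min d1 d2)"
    have "f x - c *\<^sub>R g x - (f y - c *\<^sub>R g y) - (Df (x - y) - c *\<^sub>R Dg (x - y)) =
      (f x - f y - Df (x - y)) - c *\<^sub>R (g x - g y - Dg (x - y))"
      by (simp add: algebra_simps)
    also have "norm \<dots> \<le> norm (f x - f y - Df (x - y)) + \<bar>c\<bar> * norm (g x - g y - Dg (x - y))"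
      by (metis norm_scaleR norm_triangle_ineq4)
    also have "\<dots> \<le> e / 2 * norm (x - y) + (\<bar>c\<bar> + 1) * (e' * norm (x - y))"
      using xy d1(2) d2(2) by (intro add_mono mult_mono) auto
    also have "(\<bar>c\<bar> + 1) * (e' * norm (x - y)) = e / 2 * norm (x - y)"
      by (simp add: e'_def field_simps)
    finally show "norm (f x - c *\<^sub>R g x - (f y - c *\<^sub>R g y) - (Df (x - y) - c *\<^sub>R Dg (x - y))) \<le> e * norm (x - y)"
      by simp
  qed (use d1 d2 in auto)
qed

lemma has_strict_derivative_lipschitz:
  assumes "has_strict_derivative f D x0"
  obtains d M where "d > 0" "M > 0"
    "\<And>x y. x \<in> ball x0 d \<Longrightarrow> y \<in> ball x0 d \<Longrightarrow> norm (f x - f y) \<le> M * norm (x - y)"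
proof -
  obtain d where d: "d > 0"
    "\<And>x y. x \<in> ball x0 d \<Longrightarrow> y \<in> ball x0 d \<Longrightarrow> norm (f x - f y - D (x - y)) \<le> 1 * norm (x - y)"
    using has_strict_derivativeD[OF assms, of 1] by auto
  obtain K where K: "K > 0" "\<And>h. norm (D h) \<le> norm h * K"
    using bounded_linear.pos_bounded[OF has_strict_derivative_imp_bounded_linear[OF assms]] by blast
  show thesis
  proof (rule that[of d "K + 1"])
    fix x y assume "x \<in> ball x0 d" "y \<in> ball x0 d"
    then have "norm (f x - f y - D (x - y)) \<le> norm (x - y)" using d(2)[of x y] by simp
    then show "norm (f x - f y) \<le> (K + 1) * norm (x - y)"
      using norm_triangle_ineq2[of "f x - f y" "D (x - y)"] K(2)[of "x - y"]
      by (simp add: algebra_simps)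
  qed (use d K in auto)
qed

text \<open>An injective linear map with finite-dimensional target expands lengths by at least some
  \<open>m\<close>, and a linearisation error of \<open>m / 2\<close> leaves \<open>m / 2\<close>.
  This supplies a Lipschitz inverse without differentiating any inverse map.\<close>

lemma has_strict_derivative_inj_bound:
  fixes f :: "'a::real_normed_vector \<Rightarrow> 'b::euclidean_space"
  assumes "has_strict_derivative f D x0" "inj D"
  obtains d m where "d > 0" "m > 0"
    "\<And>x y. x \<in> ball x0 d \<Longrightarrow> y \<in> ball x0 d \<Longrightarrow> m * norm (x - y) \<le> norm (f x - f y)"
proof -
  obtain m where m: "m > 0" "\<And>h. m * norm h \<le> norm (D h)"
    using linear_inj_bounded_below_pos[of D] assms has_strict_derivative_imp_bounded_linear
      bounded_linear.linear by blast
  obtain d where d: "d > 0"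
    "\<And>x y. x \<in> ball x0 d \<Longrightarrow> y \<in> ball x0 d \<Longrightarrow> norm (f x - f y - D (x - y)) \<le> m / 2 * norm (x - y)"
    using has_strict_derivativeD[OF assms(1), of "m / 2"] m by auto
  show thesis
  proof (rule that[of d "m / 2"])
    fix x y assume "x \<in> ball x0 d" "y \<in> ball x0 d"
    then have "norm (f x - f y - D (x - y)) \<le> m / 2 * norm (x - y)" using d(2) by simp
    then show "m / 2 * norm (x - y) \<le> norm (f x - f y)"
      using norm_triangle_ineq3[of "f x - f y" "D (x - y)"] m(2)[of "x - y"] by linarith
  qed (use d m in auto)
qed

lemma has_strict_derivative_cong:
  assumes "has_strict_derivative f D x0" "d > 0" "\<And>x. x \<in> ball x0 d \<Longrightarrow> f x = g x"
  shows "has_strict_derivative g D x0"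
  unfolding has_strict_derivative_def
proof (intro conjI allI impI)
  show "bounded_linear D" using assms(1) by (rule has_strict_derivative_imp_bounded_linear)
  fix e :: real assume "e > 0"
  then obtain d1 where "d1 > 0"
    "\<And>x y. x \<in> ball x0 d1 \<Longrightarrow> y \<in> ball x0 d1 \<Longrightarrow> norm (f x - f y - D (x - y)) \<le> e * norm (x - y)"
    using has_strict_derivativeD[OF assms(1)] by blast
  then have "\<forall>x\<in>ball x0 (min d d1). \<forall>y\<in>ball x0 (min d d1). norm (g x - g y - D (x - y)) \<le> e * norm (x - y)"
    using assms(3) by (metis mem_ball min_less_iff_conj)
  then show "\<exists>d>0. \<forall>x\<in>ball x0 d. \<forall>y\<in>ball x0 d. norm (g x - g y - D (x - y)) \<le> e * norm (x - y)"
    using assms(2) \<open>d1 > 0\<close> by (intro exI[of _ "min d d1"]) simp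
qed

lemma directional_derivative_tendsto:
  assumes "(f has_derivative D) (at x)"
  shows "((\<lambda>t. (1 / t) *\<^sub>R (f (x + t *\<^sub>R h) - f x)) \<longlongrightarrow> D h) (at 0)"
proof -
  have lin: "linear D" using assms by (rule has_derivative_linear)
  have "((\<lambda>t. f (x + t *\<^sub>R h)) has_derivative (\<lambda>t. D (t *\<^sub>R h))) (at 0)"
    by (rule has_derivative_compose[of "\<lambda>t. x + t *\<^sub>R h" "\<lambda>t. t *\<^sub>R h" _ _ f D])
      (auto intro!: derivative_eq_intros simp: assms)
  then have lim: "(\<lambda>t. norm (f (x + t *\<^sub>R h) - f x - D (t *\<^sub>R h)) / norm t) \<midarrow>0\<rightarrow> 0"
    by (simp add: has_derivative_at)
  have "norm (f (x + t *\<^sub>R h) - f x - D (t *\<^sub>R h)) / norm t =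
      norm ((1 / t) *\<^sub>R (f (x + t *\<^sub>R h) - f x) - D h)" if "t \<noteq> 0" for t
  proof -
    have "(1 / t) *\<^sub>R (f (x + t *\<^sub>R h) - f x) - D h = (1 / t) *\<^sub>R (f (x + t *\<^sub>R h) - f x - D (t *\<^sub>R h))"
      using that by (simp add: linear_scale[OF lin] scaleR_diff_right)
    then show ?thesis by simp
  qed
  then have "\<forall>\<^sub>F t in at 0. norm (f (x + t *\<^sub>R h) - f x - D (t *\<^sub>R h)) / norm t =
      norm ((1 / t) *\<^sub>R (f (x + t *\<^sub>R h) - f x) - D h)"
    by (simp add: eventually_at_filter)
  with lim have "((\<lambda>t. norm ((1 / t) *\<^sub>R (f (x + t *\<^sub>R h) - f x) - D h)) \<longlongrightarrow> 0) (at 0)"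
    by (rule Lim_transform_eventually)
  then show ?thesis
    by (simp add: tendsto_norm_zero_iff LIM_zero_iff)
qed

section \<open>Differentiability of the unit normal of a chart\<close>

lemma has_strict_derivative_sgn_cross:
  fixes f' :: "real^2 \<Rightarrow> (real^2) \<Rightarrow>\<^sub>L (real^3)"
  assumes U: "open U" "x0 \<in> U"
    and f': "\<And>x. x \<in> U \<Longrightarrow> (f' has_derivative blinfun_apply (f'' x)) (at x)"
    and f'': "continuous_on U f''"
    and nz: "\<And>x. x \<in> U \<Longrightarrow> cross3 (f' x a) (f' x b) \<noteq> 0"
  shows "\<exists>D. has_strict_derivative (\<lambda>x. \<sigma> *\<^sub>R sgn (cross3 (f' x a) (f' x b))) D x0"
proof -
  define c where "c x = cross3 (f' x a) (f' x b)" for x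
  define E where "E x h = cross3 (f' x a) (f'' x h b) + cross3 (f'' x h a) (f' x b)" for x h
  interpret cr: bounded_bilinear "cross3"
    using bilinear_cross by (simp add: bilinear_conv_bounded_bilinear)
  have c_deriv: "(c has_derivative E x) (at x)" if "x \<in> U" for x
    unfolding c_def E_def using f'[OF that]
    by (intro cr.FDERIV) (auto intro!: derivative_eq_intros)
  have cont: "continuous (at x0) c"
    using c_deriv[OF U(2)] by (rule has_derivative_continuous)
  have cont': "continuous (at x0) f'"
    using f'[OF U(2)] by (rule has_derivative_continuous)
  have cont'': "continuous (at x0) f''"
    using f'' U by (simp add: continuous_on_eq_continuous_at)
  have cE: "continuous (at x0) (\<lambda>x. E x h)" for h
    unfolding E_def
    by (intro continuous_intros continuous_cross cont' cont'' blinfun.continuous) 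
  have "has_strict_derivative (\<lambda>x. \<sigma> *\<^sub>R (inverse (norm (c x)) *\<^sub>R c x))
     (\<lambda>h. \<sigma> *\<^sub>R (inverse (norm (c x0)) *\<^sub>R E x0 h + (- (inverse (norm (c x0)) * (E x0 h \<bullet> sgn (c x0)) * inverse (norm (c x0)))) *\<^sub>R c x0)) x0"
  proof (rule has_strict_derivative_of_continuous[OF U, where D = "\<lambda>x h. \<sigma> *\<^sub>R (inverse (norm (c x)) *\<^sub>R E x h + (- (inverse (norm (c x)) * (E x h \<bullet> sgn (c x)) * inverse (norm (c x)))) *\<^sub>R c x)"])
    fix x assume x: "x \<in> U"
    have "c x \<noteq> 0" using nz[OF x] by (simp add: c_def)
    have "((\<lambda>x. norm (c x)) has_derivative (\<lambda>h. E x h \<bullet> sgn (c x))) (at x)"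
      by (rule has_derivative_compose[OF c_deriv[OF x] has_derivative_norm[OF \<open>c x \<noteq> 0\<close>]])
    then have "((\<lambda>x. inverse (norm (c x))) has_derivative
      (\<lambda>h. - (inverse (norm (c x)) * (E x h \<bullet> sgn (c x)) * inverse (norm (c x))))) (at x)"
      using \<open>c x \<noteq> 0\<close> by (intro Deriv.has_derivative_inverse) auto
    then show "((\<lambda>x. \<sigma> *\<^sub>R (inverse (norm (c x)) *\<^sub>R c x)) has_derivative
      (\<lambda>h. \<sigma> *\<^sub>R (inverse (norm (c x)) *\<^sub>R E x h + (- (inverse (norm (c x)) * (E x h \<bullet> sgn (c x)) * inverse (norm (c x)))) *\<^sub>R c x))) (at x)"
      by (intro has_derivative_scaleR_right has_derivative_scaleR c_deriv x)
  next
    fix i :: "real^2"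
    have "c x0 \<noteq> 0" using nz[OF U(2)] by (simp add: c_def)
    then show "continuous (at x0) (\<lambda>x. \<sigma> *\<^sub>R (inverse (norm (c x)) *\<^sub>R E x i + (- (inverse (norm (c x)) * (E x i \<bullet> sgn (c x)) * inverse (norm (c x)))) *\<^sub>R c x))"
      unfolding sgn_div_norm
      by (intro continuous_intros cont cE) auto
  qed
  then show ?thesis
    unfolding c_def sgn_div_norm by blast
qed

section \<open>Boundary charts\<close>

text \<open>The derivatives \<open>f'\<close> and \<open>f''\<close> are parameters, since
  \<open>C2_on\<close> only asserts that they exist; fixing them once lets all estimates share the
  same functions.\<close>

locale boundary_chart = constant_width_body B w
  for B :: "(real^3) set" and w +
  fixes S V :: "(real^3) set" and U :: "(real^2) set" and \<phi> \<psi>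
    and f' :: "real^2 \<Rightarrow> (real^2) \<Rightarrow>\<^sub>L (real^3)" and f''
  assumes openin: "openin (top_of_set (frontier B)) S" and V: "open V" and U: "open U"
    and \<phi>': "\<And>x. x \<in> U \<Longrightarrow> (\<phi> has_derivative blinfun_apply (f' x)) (at x)"
    and f': "\<And>x. x \<in> U \<Longrightarrow> (f' has_derivative blinfun_apply (f'' x)) (at x)"
    and f'': "continuous_on U f''"
    and inj: "\<And>x. x \<in> U \<Longrightarrow> inj (f' x)"
    and homeo: "homeomorphism U (S \<inter> V) \<phi> \<psi>"
begin

lemma chart_mem: "x \<in> U \<Longrightarrow> \<phi> x \<in> S" "x \<in> U \<Longrightarrow> \<phi> x \<in> B" "x \<in> U \<Longrightarrow> \<phi> x \<in> frontier B"
proof -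
  assume x: "x \<in> U"
  show S: "\<phi> x \<in> S" using homeo x by (auto simp: homeomorphism_def)
  show "\<phi> x \<in> frontier B" using S openin_imp_subset[OF openin] by blast
  then show "\<phi> x \<in> B"
    using frontier_subset_closed[of B] compact_imp_closed[OF compact_body] by blast
qed

text \<open>Relative openness of \<open>S\<close> in the boundary is what guarantees that every
  boundary point near \<open>\<phi> x0\<close> belongs to the chart, and continuity of
  \<open>\<psi>\<close> makes its parameter close to \<open>x0\<close>. Support points given only by
  their position thereby acquire parameters.\<close>

lemma frontier_near_chart:
  assumes x0: "x0 \<in> U" and d: "d > 0"
  obtains \<delta> where "\<delta> > 0"
    "\<And>y. y \<in> frontier B \<Longrightarrow> norm (y - \<phi> x0) < \<delta> \<Longrightarrow> y \<in> S \<and> \<psi> y \<in> U \<and> \<psi> y \<in> ball x0 d \<and> \<phi> (\<psi> y) = y"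
proof -
  obtain T where T: "open T" "S = frontier B \<inter> T"
    using openin by (auto simp: openin_open)
  have p: "\<phi> x0 \<in> S \<inter> V" and \<psi>p: "\<psi> (\<phi> x0) = x0"
    using homeo x0 by (auto simp: homeomorphism_def)
  have "continuous_on (S \<inter> V) \<psi>" using homeo by (simp add: homeomorphism_def)
  then obtain d1 where d1: "d1 > 0" "\<And>y. y \<in> S \<inter> V \<Longrightarrow> dist y (\<phi> x0) < d1 \<Longrightarrow> dist (\<psi> y) x0 < d"
    using p d \<psi>p unfolding continuous_on_iff by metis
  obtain d2 where d2: "d2 > 0" "ball (\<phi> x0) d2 \<subseteq> T \<inter> V"
    using T V p by (meson IntD1 IntD2 IntI openE open_Int)
  show thesis
  proof (rule that[of "min d1 d2"])
    show "min d1 d2 > 0" using d1 d2 by simp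
    fix y assume y: "y \<in> frontier B" "norm (y - \<phi> x0) < min d1 d2"
    then have "y \<in> ball (\<phi> x0) d2" by (simp add: dist_norm norm_minus_commute)
    then have "y \<in> S \<inter> V" using d2 T y(1) by blast
    moreover have "dist y (\<phi> x0) < d1" using y by (simp add: dist_norm)
    ultimately show "y \<in> S \<and> \<psi> y \<in> U \<and> \<psi> y \<in> ball x0 d \<and> \<phi> (\<psi> y) = y"
      using d1(2) homeo by (auto simp: homeomorphism_def dist_commute)
  qed
qed

lemma strict_chart:
  assumes "x0 \<in> U"
  shows "has_strict_derivative \<phi> (f' x0) x0"
proof (rule has_strict_derivative_of_continuous[OF U assms \<phi>'])
  show "continuous (at x0) (\<lambda>x. blinfun_apply (f' x) i)" for i
    by (intro continuous_intros has_derivative_continuous[OF f'[OF assms]])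
qed

lemma supports_chart_orthogonal:
  assumes x: "x \<in> U" and u: "supports B u (\<phi> x)"
  shows "u \<bullet> f' x h = 0"
proof -
  have "((\<lambda>x. u \<bullet> \<phi> x) has_derivative (\<lambda>h. u \<bullet> f' x h)) (at x)"
    by (intro derivative_eq_intros) (use \<phi>'[OF x] in auto)
  moreover have "\<forall>y\<in>U. u \<bullet> \<phi> y \<le> u \<bullet> \<phi> x"
    using u inner_le_support_fun[OF compact_body chart_mem(2)] by (simp add: supports_def)
  ultimately have "(\<lambda>h. u \<bullet> f' x h) = (\<lambda>h. 0)"
    using differential_zero_maxmin[OF x U] by blast
  then show ?thesis by metis
qed

definition chart_normal :: "real^2 \<Rightarrow> real^3" where
  "chart_normal x = sgn (cross3 (f' x (axis 1 1)) (f' x (axis 2 1)))"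

lemma chart_cross_nonzero:
  assumes "x \<in> U"
  shows "cross3 (f' x (axis 1 1)) (f' x (axis 2 1)) \<noteq> 0"
proof
  assume "cross3 (f' x (axis 1 1)) (f' x (axis 2 1)) = 0"
  then consider "f' x (axis 1 1) = 0" | "f' x (axis 2 1) = 0" | c where "f' x (axis 2 1) = c *\<^sub>R f' x (axis 1 1)"
    unfolding cross_eq_0 collinear_lemma by blast
  then show False
  proof cases
    case 1
    then have "axis 1 1 = (0 :: real^2)"
      using injD[OF inj[OF assms], of "axis 1 1" 0] by simp
    then show False by (simp add: axis_eq_0_iff)
  next
    case 2
    then have "axis 2 1 = (0 :: real^2)"
      using injD[OF inj[OF assms], of "axis 2 1" 0] by simp
    then show False by (simp add: axis_eq_0_iff)
  next
    case 3
    then have "axis 2 1 = (c *\<^sub>R axis 1 1 :: real^2)"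
      using injD[OF inj[OF assms], of "axis 2 1" "c *\<^sub>R axis 1 1"] by (simp add: blinfun.scaleR_right)
    then show False
      by (auto simp: vec_eq_iff axis_def forall_2)
  qed
qed

text \<open>By the triple product identity, a vector orthogonal to both tangent vectors has zero
  cross product with their cross product, so it is a multiple of it.\<close>

lemma orthogonal_chart_normal:
  assumes x: "x \<in> U" and u: "norm u = 1" and orth: "\<And>h. u \<bullet> f' x h = 0"
  shows "u = chart_normal x \<or> u = - chart_normal x"
proof -
  let ?c = "cross3 (f' x (axis 1 1)) (f' x (axis 2 1))"
  have "cross3 u ?c = 0"
    by (simp add: Lagrange orth)
  moreover have "u \<noteq> 0" using u by auto
  ultimately obtain k where k: "?c = k *\<^sub>R u"
    using chart_cross_nonzero[OF x] unfolding cross_eq_0 collinear_lemma by blast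
  then have "k \<noteq> 0" using chart_cross_nonzero[OF x] by auto
  have "chart_normal x = sgn k *\<^sub>R u"
    unfolding chart_normal_def k using u by (simp add: sgn_scaleR sgn_div_norm)
  then show ?thesis
    using \<open>k \<noteq> 0\<close> by (cases "k > 0") auto
qed

text \<open>Two different candidates would be opposite, and the body would then have width zero in
  that direction.\<close>

lemma normal_unique:
  assumes x: "x \<in> U" and u: "norm u = 1" "\<And>h. u \<bullet> f' x h = 0" "\<And>y. y \<in> B \<Longrightarrow> u \<bullet> (y - \<phi> x) \<le> 0"
    and v: "norm v = 1" "\<And>h. v \<bullet> f' x h = 0" "\<And>y. y \<in> B \<Longrightarrow> v \<bullet> (y - \<phi> x) \<le> 0"
  shows "u = v"
proof (rule ccontr)
  assume "u \<noteq> v"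
  then have uv: "v = - u"
    using orthogonal_chart_normal[OF x u(1,2)] orthogonal_chart_normal[OF x v(1,2)] by auto
  have "supports B u (\<phi> x)" "supports B (- u) (\<phi> x)"
    using u(3) v(3) chart_mem(2)[OF x] unfolding uv
    by (auto intro!: supportsI compact_body simp: inner_diff_right)
  then have "support_fun B u + support_fun B (- u) = 0"
    by (auto simp: supports_def)
  then show False
    using support_fun_minus[OF u(1)] w_pos by simp
qed

lemma supports_chart_exists:
  assumes x: "x \<in> U"
  obtains u where "norm u = 1" "supports B u (\<phi> x)"
proof -
  have "\<phi> x \<notin> interior B"
    using chart_mem(3)[OF x] by (simp add: frontier_def)
  then obtain a b where ab: "a \<noteq> 0" "\<forall>y\<in>interior B. a \<bullet> y \<le> b" "b \<le> a \<bullet> \<phi> x"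
    using separating_hyperplane_sets[of "interior B" "{\<phi> x}"] convex_body interior_body by auto
  have "closure (interior B) \<subseteq> {y. a \<bullet> y \<le> b}"
    using ab(2) by (intro closure_minimal closed_halfspace_le) auto
  then have "a \<bullet> y \<le> a \<bullet> \<phi> x" if "y \<in> B" for y
    using that ab(3) convex_closure_interior[OF convex_body interior_body] closure_subset by force
  then have "supports B (sgn a) (\<phi> x)"
    by (intro supportsI compact_body chart_mem x) (auto simp: sgn_div_norm intro!: mult_left_mono)
  then show thesis
    using that[of "sgn a"] ab(1) by (simp add: norm_sgn)
qed

text \<open>Along \<open>S\<close> the linear map \<open>P\<close>, which fixes tangent vectors,
  misses a point only to higher order. The inverse Lipschitz bound of the chart turns smallness in
  the parameter into smallness in space. Applied to arbitrary curves in \<open>S\<close>, this shows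
  that their velocities are tangent, without any differentiability of \<open>\<psi>\<close>.\<close>

lemma tangent_deviation_has_derivative_zero:
  assumes x0: "x0 \<in> U" and P: "bounded_linear P" and PA: "\<And>h. P (f' x0 h) = f' x0 h"
  shows "((\<lambda>y. y - P y) has_derivative (\<lambda>h. 0)) (at (\<phi> x0) within S)"
    (is "(?g has_derivative _) _")
  unfolding has_derivative_within_alt
proof (intro conjI allI impI)
  have blg: "bounded_linear ?g" by (intro bounded_linear_sub bounded_linear_ident P)
  fix e :: real assume e: "e > 0"
  obtain K where K: "K > 0" "\<And>z. norm (?g z) \<le> norm z * K"
    using bounded_linear.pos_bounded[OF blg] by blast
  obtain d1 m where m: "d1 > 0" "m > 0" "\<And>x y. x \<in> ball x0 d1 \<Longrightarrow> y \<in> ball x0 d1 \<Longrightarrow> m * norm (x - y) \<le> norm (\<phi> x - \<phi> y)"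
    using has_strict_derivative_inj_bound[OF strict_chart[OF x0] inj[OF x0]] by blast
  have "e * m / K > 0" using e m K by simp
  then obtain d2 where d2: "d2 > 0" "\<And>x y. x \<in> ball x0 d2 \<Longrightarrow> y \<in> ball x0 d2 \<Longrightarrow>
      norm (\<phi> x - \<phi> y - f' x0 (x - y)) \<le> e * m / K * norm (x - y)"
    using has_strict_derivativeD[OF strict_chart[OF x0]] by blast
  obtain \<delta> where \<delta>: "\<delta> > 0" "\<And>y. y \<in> frontier B \<Longrightarrow> norm (y - \<phi> x0) < \<delta> \<Longrightarrow> y \<in> S \<and> \<psi> y \<in> U \<and> \<psi> y \<in> ball x0 (min d1 d2) \<and> \<phi> (\<psi> y) = y"
    using frontier_near_chart[OF x0, of "min d1 d2"] m d2 by auto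
  show "\<exists>d>0. \<forall>y\<in>S. norm (y - \<phi> x0) < d \<longrightarrow> norm (?g y - ?g (\<phi> x0) - 0) \<le> e * norm (y - \<phi> x0)"
  proof (intro exI[of _ \<delta>] conjI ballI impI \<open>\<delta> > 0\<close>)
    fix y assume "y \<in> S" "norm (y - \<phi> x0) < \<delta>"
    then have y: "\<psi> y \<in> ball x0 (min d1 d2)" "\<phi> (\<psi> y) = y"
      using \<delta>(2) openin_imp_subset[OF openin] by blast+
    define x where "x = \<psi> y"
    have x: "x \<in> ball x0 d1" "x \<in> ball x0 d2" "\<phi> x = y" using y by (auto simp: x_def)
    have "?g (f' x0 (x - x0)) = 0" by (simp add: PA)
    then have "?g y - ?g (\<phi> x0) - 0 = ?g (y - \<phi> x0 - f' x0 (x - x0))"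
      by (simp add: linear_diff[OF bounded_linear.linear[OF blg]] linear_diff[OF bounded_linear.linear[OF P]] PA)
    also have "norm \<dots> \<le> norm (y - \<phi> x0 - f' x0 (x - x0)) * K" by (rule K)
    also have "\<dots> \<le> (e * m / K * norm (x - x0)) * K"
      using d2(2)[OF x(2), of x0] d2(1) K x(3) by (intro mult_right_mono) auto
    also have "\<dots> = e * (m * norm (x - x0))" using K by simp
    also have "\<dots> \<le> e * norm (y - \<phi> x0)"
      using m(3)[OF x(1), of x0] m(1) e x(3) by (intro mult_left_mono) auto
    finally show "norm (?g y - ?g (\<phi> x0) - 0) \<le> e * norm (y - \<phi> x0)" .
  qed
qed (rule bounded_linear_zero)

lemma curve_derivative:
  assumes c: "\<And>t. t \<in> {-\<epsilon><..<\<epsilon>} \<Longrightarrow> c t \<in> S" "\<epsilon> > 0" "c 0 = p" "(c has_vector_derivative v) (at 0)"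
    and g: "(g has_derivative L) (at p within S)"
  shows "((\<lambda>t. g (c t)) has_vector_derivative L v) (at 0)"
proof -
  have op: "open {-\<epsilon><..<\<epsilon>}" "0 \<in> {-\<epsilon><..<\<epsilon>}" using c by auto
  have "(c has_derivative (\<lambda>t. t *\<^sub>R v)) (at 0 within {-\<epsilon><..<\<epsilon>})"
    using c(4) unfolding has_vector_derivative_def by (rule has_derivative_at_withinI)
  moreover have "(g has_derivative L) (at (c 0) within c ` {-\<epsilon><..<\<epsilon>})"
    unfolding c(3) using g c(1) by (intro has_derivative_subset[OF g]) auto
  ultimately have "((\<lambda>t. g (c t)) has_derivative (\<lambda>t. L (t *\<^sub>R v))) (at 0 within {-\<epsilon><..<\<epsilon>})"
    by (rule has_derivative_in_compose)
  then show ?thesis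
    using at_within_open[OF op(2,1)] linear_scale[OF has_derivative_linear[OF g]]
    by (simp add: has_vector_derivative_def)
qed

lemma chart_curve:
  assumes x0: "x0 \<in> U"
  obtains \<epsilon> where "\<epsilon> > 0" "\<And>t. t \<in> {-\<epsilon><..<\<epsilon>} \<Longrightarrow> \<phi> (x0 + t *\<^sub>R h) \<in> S \<and> (\<lambda>t. \<phi> (x0 + t *\<^sub>R h)) differentiable (at t)"
    "((\<lambda>t. \<phi> (x0 + t *\<^sub>R h)) has_vector_derivative f' x0 h) (at 0)"
proof -
  have deriv: "((\<lambda>t. \<phi> (x0 + t *\<^sub>R h)) has_derivative (\<lambda>s. f' (x0 + t *\<^sub>R h) (s *\<^sub>R h))) (at t)"
    if "x0 + t *\<^sub>R h \<in> U" for t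
    by (rule has_derivative_compose[of "\<lambda>t. x0 + t *\<^sub>R h" "\<lambda>s. s *\<^sub>R h"])
      (auto intro!: derivative_eq_intros \<phi>' that)
  have "open ((\<lambda>t. x0 + t *\<^sub>R h) -` U)"
    by (intro open_vimage U continuous_intros)
  moreover have "0 \<in> (\<lambda>t. x0 + t *\<^sub>R h) -` U" using x0 by simp
  ultimately obtain \<epsilon> where \<epsilon>: "\<epsilon> > 0" "ball 0 \<epsilon> \<subseteq> (\<lambda>t. x0 + t *\<^sub>R h) -` U"
    by (meson openE)
  have mem: "x0 + t *\<^sub>R h \<in> U" if "t \<in> {-\<epsilon><..<\<epsilon>}" for t
  proof -
    have "t \<in> ball 0 \<epsilon>" using that by auto
    then show ?thesis using \<epsilon>(2) by blast
  qed
  show thesis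
  proof (rule that[OF \<epsilon>(1)])
    fix t assume "t \<in> {-\<epsilon><..<\<epsilon>}"
    then show "\<phi> (x0 + t *\<^sub>R h) \<in> S \<and> (\<lambda>t. \<phi> (x0 + t *\<^sub>R h)) differentiable (at t)"
      using mem deriv chart_mem(1) differentiableI by blast
  next
    show "((\<lambda>t. \<phi> (x0 + t *\<^sub>R h)) has_vector_derivative f' x0 h) (at 0)"
      using deriv[of 0] x0 by (simp add: has_vector_derivative_def blinfun.scaleR_right)
  qed
qed

lemma chart_left_inverse:
  assumes "x \<in> U"
  obtains G where "bounded_linear G" "\<And>h. G (f' x h) = h"
proof -
  have "linear (f' x)" by (simp add: bounded_linear.linear blinfun.bounded_linear_right)
  then obtain G where "linear G" "G \<circ> f' x = id"
    using linear_injective_left_inverse inj[OF assms] by blast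
  then show thesis
    using that[of G] by (simp add: linear_conv_bounded_linear pointfree_idE)
qed

lemma tangent_plane_chart:
  assumes x0: "x0 \<in> U"
  shows "tangent_plane S (\<phi> x0) = range (f' x0)"
proof (intro equalityI subsetI)
  fix v assume "v \<in> range (f' x0)"
  then obtain h where h: "v = f' x0 h" by blast
  obtain \<epsilon> where "\<epsilon> > 0" "\<And>t. t \<in> {-\<epsilon><..<\<epsilon>} \<Longrightarrow> \<phi> (x0 + t *\<^sub>R h) \<in> S \<and> (\<lambda>t. \<phi> (x0 + t *\<^sub>R h)) differentiable (at t)"
    "((\<lambda>t. \<phi> (x0 + t *\<^sub>R h)) has_vector_derivative f' x0 h) (at 0)"
    using chart_curve[OF x0, of h] by blast
  then show "v \<in> tangent_plane S (\<phi> x0)"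
    unfolding tangent_plane_def h
    by (intro CollectI exI[of _ \<epsilon>] conjI exI[of _ "\<lambda>t. \<phi> (x0 + t *\<^sub>R h)"]) auto
next
  fix v assume "v \<in> tangent_plane S (\<phi> x0)"
  then obtain \<epsilon> c where c: "\<epsilon> > 0" "\<And>t. t \<in> {-\<epsilon><..<\<epsilon>} \<Longrightarrow> c t \<in> S" "c 0 = \<phi> x0" "(c has_vector_derivative v) (at 0)"
    unfolding tangent_plane_def by blast
  obtain G where G: "bounded_linear G" "\<And>h. G (f' x0 h) = h"
    using chart_left_inverse[OF x0] by blast
  define P where "P z = f' x0 (G z)" for z
  have P: "bounded_linear P"
    unfolding P_def by (intro bounded_linear_compose[OF _ G(1)] blinfun.bounded_linear_right)
  \<comment> \<open>The deviation \<open>c t - P (c t)\<close> has derivative 0 since the curve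
    stays in \<open>S\<close>, and derivative \<open>v - P v\<close> by linearity; so
    \<open>v = P v\<close> lies in the range of \<open>f' x0\<close>.\<close>
  have "((\<lambda>t. c t - P (c t)) has_vector_derivative 0) (at 0)"
    using tangent_deviation_has_derivative_zero[OF x0 P] G(2)
    by (intro curve_derivative[OF c(2) c(1,3,4)]) (auto simp: P_def)
  moreover have "((\<lambda>t. c t - P (c t)) has_vector_derivative v - P v) (at 0)"
    by (intro has_vector_derivative_diff c(4) bounded_linear.has_vector_derivative[OF P])
  ultimately have "v - P v = 0"
    by (metis vector_derivative_unique_at)
  then show "v \<in> range (f' x0)"
    unfolding P_def by (metis eq_iff_diff_eq_0 rangeI)
qed

lemma outward_unit_normal_eq:
  assumes x: "x \<in> U" and u: "norm u = 1" "supports B u (\<phi> x)"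
  shows "outward_unit_normal B S (\<phi> x) = u"
  unfolding outward_unit_normal_def tangent_plane_chart[OF x]
proof (rule the_equality)
  have le: "u \<bullet> (y - \<phi> x) \<le> 0" if "y \<in> B" for y
    using inner_le_support_fun[OF compact_body that, of u] u(2) by (simp add: supports_def inner_diff_right)
  show "norm u = 1 \<and> (\<forall>v\<in>range (f' x). u \<bullet> v = 0) \<and> (\<forall>y\<in>B. u \<bullet> (y - \<phi> x) \<le> 0)"
    using u supports_chart_orthogonal[OF x u(2)] le by auto
  fix n assume "norm n = 1 \<and> (\<forall>v\<in>range (f' x). n \<bullet> v = 0) \<and> (\<forall>y\<in>B. n \<bullet> (y - \<phi> x) \<le> 0)"
  then show "n = u"
    using normal_unique[OF x, of n u] u supports_chart_orthogonal[OF x u(2)] le by auto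
qed

lemma outward_unit_normal_supports:
  assumes x: "x \<in> U"
  shows "norm (outward_unit_normal B S (\<phi> x)) = 1" "supports B (outward_unit_normal B S (\<phi> x)) (\<phi> x)"
  using supports_chart_exists[OF x] outward_unit_normal_eq[OF x] by metis+

end

section \<open>Principal curvatures in a chart\<close>

lemma finite_real_eigenvalues:
  fixes M :: "real^2 \<Rightarrow> real^2"
  assumes "linear M"
  shows "finite {\<kappa>. \<exists>d. d \<noteq> 0 \<and> M d = \<kappa> *\<^sub>R d}"
proof -
  define m where "m i j = M (axis j 1) $ i" for i j
  have M: "M d $ i = m i 1 * d $ 1 + m i 2 * d $ 2" for d i
  proof -
    have "d = d $ 1 *\<^sub>R axis 1 1 + d $ 2 *\<^sub>R axis 2 1"
      by (simp add: vec_eq_iff forall_2 axis_def)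
    then have "M d = M (d $ 1 *\<^sub>R axis 1 1 + d $ 2 *\<^sub>R axis 2 1)"
      by (rule arg_cong)
    also have "\<dots> = d $ 1 *\<^sub>R M (axis 1 1) + d $ 2 *\<^sub>R M (axis 2 1)"
      by (simp only: linear_add[OF assms] linear_scale[OF assms])
    finally show ?thesis by (simp add: m_def mult.commute)
  qed
  define b c where "b = m 1 1 + m 2 2" and "c = m 1 1 * m 2 2 - m 1 2 * m 2 1"
  have eq: "\<kappa> * \<kappa> - b * \<kappa> + c = 0" if d: "d \<noteq> 0" "M d = \<kappa> *\<^sub>R d" for \<kappa> d
  proof -
    have 1: "(m 1 1 - \<kappa>) * d $ 1 + m 1 2 * d $ 2 = 0" "m 2 1 * d $ 1 + (m 2 2 - \<kappa>) * d $ 2 = 0"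
      using M[of d 1] M[of d 2] d(2) by (simp_all add: algebra_simps)
    define q where "q = (m 1 1 - \<kappa>) * (m 2 2 - \<kappa>) - m 1 2 * m 2 1"
    \<comment> \<open>The adjugate matrix is applied to the singular system, so the characteristic
      determinant \<open>q\<close> annihilates \<open>d\<close>.\<close>
    have "q * d $ 1 = (m 2 2 - \<kappa>) * ((m 1 1 - \<kappa>) * d $ 1 + m 1 2 * d $ 2) - m 1 2 * (m 2 1 * d $ 1 + (m 2 2 - \<kappa>) * d $ 2)"
      "q * d $ 2 = (m 1 1 - \<kappa>) * (m 2 1 * d $ 1 + (m 2 2 - \<kappa>) * d $ 2) - m 2 1 * ((m 1 1 - \<kappa>) * d $ 1 + m 1 2 * d $ 2)"
      by (simp_all add: q_def algebra_simps)
    then have "q * d $ 1 = 0" "q * d $ 2 = 0" unfolding 1 by simp_all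
    moreover have "d $ 1 \<noteq> 0 \<or> d $ 2 \<noteq> 0"
      using d(1) by (auto simp: vec_eq_iff forall_2)
    ultimately have "q = 0" by auto
    then show ?thesis by (simp add: q_def b_def c_def algebra_simps)
  qed
  show ?thesis
  proof (cases "{\<kappa>. \<exists>d. d \<noteq> 0 \<and> M d = \<kappa> *\<^sub>R d} = {}")
    case False
    then obtain \<kappa>0 where k0: "\<kappa>0 * \<kappa>0 - b * \<kappa>0 + c = 0" using eq by blast
    have "\<kappa> = \<kappa>0 \<or> \<kappa> = b - \<kappa>0" if "\<kappa> * \<kappa> - b * \<kappa> + c = 0" for \<kappa>
    proof -
      have "(\<kappa> - \<kappa>0) * (\<kappa> - (b - \<kappa>0)) = (\<kappa> * \<kappa> - b * \<kappa> + c) - (\<kappa>0 * \<kappa>0 - b * \<kappa>0 + c)"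
        by (simp add: algebra_simps)
      then have "(\<kappa> - \<kappa>0) * (\<kappa> - (b - \<kappa>0)) = 0" using that k0 by simp
      then show ?thesis by auto
    qed
    then have "{\<kappa>. \<exists>d. d \<noteq> 0 \<and> M d = \<kappa> *\<^sub>R d} \<subseteq> {\<kappa>0, b - \<kappa>0}" using eq by blast
    then show ?thesis by (rule finite_subset) simp
  next
    case True
    then show ?thesis by (simp only: finite.emptyI)
  qed
qed

context boundary_chart
begin

abbreviation N :: "real^2 \<Rightarrow> real^3" where
  "N x \<equiv> outward_unit_normal B S (\<phi> x)"

text \<open>The outward normal is \<open>chart_normal\<close> up to a sign depending on the point.
  The sign is constant near \<open>x0\<close>, because outward normals have negative inner product
  with the vector to a fixed interior point \<open>z\<close>, and this inner product is continuous
  for a fixed sign.\<close>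

lemma strict_normal:
  assumes x0: "x0 \<in> U"
  obtains D where "has_strict_derivative N D x0"
proof -
  obtain z where z: "z \<in> interior B" using interior_body by blast
  have neg: "N x \<bullet> (z - \<phi> x) < 0" if x: "x \<in> U" for x
  proof -
    obtain e where e: "e > 0" "cball z e \<subseteq> B" using z by (auto simp: mem_interior_cball)
    have N: "norm (N x) = 1" "supports B (N x) (\<phi> x)" using outward_unit_normal_supports[OF x] by auto
    have "z + e *\<^sub>R N x \<in> B" using e N by (intro subsetD[OF e(2)]) (simp add: dist_norm)
    then have "N x \<bullet> (z + e *\<^sub>R N x) \<le> N x \<bullet> \<phi> x"
      using inner_le_support_fun[OF compact_body] N(2) by (simp add: supports_def)
    then show ?thesis
      using N(1) e(1) by (simp add: inner_add_right inner_diff_right norm_eq_1)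
  qed
  have pm: "N x = chart_normal x \<or> N x = - chart_normal x" if x: "x \<in> U" for x
    using outward_unit_normal_supports[OF x] supports_chart_orthogonal[OF x] orthogonal_chart_normal[OF x]
    by blast
  obtain \<sigma> :: real where \<sigma>: "\<sigma> = 1 \<or> \<sigma> = - 1" "N x0 = \<sigma> *\<^sub>R chart_normal x0"
    using pm[OF x0] by (metis scaleR_minus1_left scaleR_one)
  obtain D where D: "has_strict_derivative (\<lambda>x. \<sigma> *\<^sub>R chart_normal x) D x0"
    unfolding chart_normal_def
    using has_strict_derivative_sgn_cross[OF U x0 f' f'' chart_cross_nonzero] by blast
  define g where "g x = (\<sigma> *\<^sub>R chart_normal x) \<bullet> (z - \<phi> x)" for x
  have "isCont g x0"
    unfolding g_def
    by (intro continuous_intros has_derivative_continuous[OF has_strict_derivative_imp_has_derivative[OF D]]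
        has_derivative_continuous[OF \<phi>'[OF x0]])
  moreover have "g x0 < 0" using neg[OF x0] \<sigma>(2) by (simp add: g_def)
  ultimately have "\<forall>\<^sub>F x in at x0. g x < 0"
    unfolding isCont_def by (rule order_tendstoD)
  then obtain d1 where d1: "d1 > 0" "\<And>x. x \<noteq> x0 \<Longrightarrow> dist x x0 < d1 \<Longrightarrow> g x < 0"
    unfolding eventually_at by blast
  obtain d2 where d2: "d2 > 0" "ball x0 d2 \<subseteq> U" using U x0 by (meson openE)
  have "\<sigma> *\<^sub>R chart_normal x = N x" if x: "x \<in> ball x0 (min d1 d2)" for x
  proof (rule ccontr)
    assume ne: "\<sigma> *\<^sub>R chart_normal x \<noteq> N x"
    have xU: "x \<in> U" using x d2 by auto
    then have "N x = - (\<sigma> *\<^sub>R chart_normal x)" using pm[OF xU] ne \<sigma>(1) by auto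
    then have "g x > 0" using neg[OF xU] by (simp add: g_def)
    then show False
      using d1(2)[of x] x \<open>g x0 < 0\<close> by (cases "x = x0") (auto simp: dist_commute)
  qed
  then have "has_strict_derivative N D x0"
    using has_strict_derivative_cong[OF D, of "min d1 d2" N] d1 d2 by simp
  then show thesis by (rule that)
qed

context
  fixes x0 D
  assumes x0: "x0 \<in> U" and D: "has_strict_derivative N D x0"
begin

text \<open>Near \<open>\<phi> x0\<close> the normal on \<open>S\<close> is \<open>N\<close> at the
  parameter \<open>\<psi> y\<close>. A linear left inverse \<open>G\<close> of \<open>f' x0\<close>
  stands in for the derivative of \<open>\<psi>\<close>, and the inverse Lipschitz bound of
  \<open>\<phi>\<close> controls the error.\<close>

lemma normal_has_derivative:
  assumes G: "bounded_linear G" "\<And>h. G (f' x0 h) = h"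
  shows "(outward_unit_normal B S has_derivative (\<lambda>v. D (G v))) (at (\<phi> x0) within S)"
  unfolding has_derivative_within_alt
proof (intro conjI allI impI)
  have blD: "bounded_linear D" using D by (rule has_strict_derivative_imp_bounded_linear)
  show blDG: "bounded_linear (\<lambda>v. D (G v))" by (rule bounded_linear_compose[OF blD G(1)])
  fix e :: real assume e: "e > 0"
  obtain K where K: "K > 0" "\<And>z. norm (D (G z)) \<le> norm z * K"
    using bounded_linear.pos_bounded[OF blDG] by blast
  obtain d1 m where m: "d1 > 0" "m > 0" "\<And>x y. x \<in> ball x0 d1 \<Longrightarrow> y \<in> ball x0 d1 \<Longrightarrow> m * norm (x - y) \<le> norm (\<phi> x - \<phi> y)"
    using has_strict_derivative_inj_bound[OF strict_chart[OF x0] inj[OF x0]] by blast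
  \<comment> \<open>Each of the two linearisation errors may use half of \<open>e\<close>; the
    factor \<open>m\<close> pays for passing from parameters to points, and \<open>K\<close> is the
    norm bound of the composed map.\<close>
  have e': "e * m / (2 * K) > 0" "e * m / 2 > 0" using e m K by simp_all
  obtain d2 where d2: "d2 > 0" "\<And>x y. x \<in> ball x0 d2 \<Longrightarrow> y \<in> ball x0 d2 \<Longrightarrow>
      norm (\<phi> x - \<phi> y - f' x0 (x - y)) \<le> e * m / (2 * K) * norm (x - y)"
    using has_strict_derivativeD[OF strict_chart[OF x0] e'(1)] by blast
  obtain d3 where d3: "d3 > 0" "\<And>x y. x \<in> ball x0 d3 \<Longrightarrow> y \<in> ball x0 d3 \<Longrightarrow>
      norm (N x - N y - D (x - y)) \<le> e * m / 2 * norm (x - y)"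
    using has_strict_derivativeD[OF D e'(2)] by blast
  define d where "d = min d1 (min d2 d3)"
  have "d > 0" using m d2 d3 by (simp add: d_def)
  obtain \<delta> where \<delta>: "\<delta> > 0" "\<And>y. y \<in> frontier B \<Longrightarrow> norm (y - \<phi> x0) < \<delta> \<Longrightarrow> y \<in> S \<and> \<psi> y \<in> U \<and> \<psi> y \<in> ball x0 d \<and> \<phi> (\<psi> y) = y"
    using frontier_near_chart[OF x0 \<open>d > 0\<close>] by blast
  show "\<exists>d>0. \<forall>y\<in>S. norm (y - \<phi> x0) < d \<longrightarrow>
    norm (outward_unit_normal B S y - N x0 - D (G (y - \<phi> x0))) \<le> e * norm (y - \<phi> x0)"
  proof (intro exI[of _ \<delta>] conjI ballI impI \<open>\<delta> > 0\<close>)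
    fix y assume "y \<in> S" "norm (y - \<phi> x0) < \<delta>"
    then have y: "\<psi> y \<in> ball x0 d" "\<phi> (\<psi> y) = y"
      using \<delta>(2) openin_imp_subset[OF openin] by blast+
    define x where "x = \<psi> y"
    have x: "x \<in> ball x0 d1" "x \<in> ball x0 d2" "x \<in> ball x0 d3" "\<phi> x = y" using y by (auto simp: x_def d_def)
    have DGf: "D (G (f' x0 (x - x0))) = D (x - x0)" by (simp add: G)
    have "outward_unit_normal B S y - N x0 - D (G (y - \<phi> x0)) =
      (N x - N x0 - D (x - x0)) - D (G (y - \<phi> x0 - f' x0 (x - x0)))"
      unfolding linear_diff[OF bounded_linear.linear[OF blDG]] DGf x(4) by simp
    also have "norm \<dots> \<le> norm (N x - N x0 - D (x - x0)) + norm (D (G (y - \<phi> x0 - f' x0 (x - x0))))"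
      by (rule norm_triangle_ineq4)
    also have "\<dots> \<le> e * m / 2 * norm (x - x0) + norm (y - \<phi> x0 - f' x0 (x - x0)) * K"
      using d3 x by (intro add_mono K) auto
    also have "\<dots> \<le> e * m / 2 * norm (x - x0) + (e * m / (2 * K) * norm (x - x0)) * K"
      using d2(2)[OF x(2), of x0] d2(1) K x(4) by (intro add_mono mult_right_mono) auto
    also have "\<dots> = e * (m * norm (x - x0))" using K by simp
    also have "\<dots> \<le> e * norm (y - \<phi> x0)"
      using m(3)[OF x(1), of x0] m(1) e x(4) by (intro mult_left_mono) auto
    finally show "norm (outward_unit_normal B S y - N x0 - D (G (y - \<phi> x0))) \<le> e * norm (y - \<phi> x0)" .
  qed
qed

text \<open>A derivative within \<open>S\<close> may be arbitrary off the tangent plane. Along chart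
  curves it is determined by differentiating the composition, so all such derivatives agree on
  tangent vectors.\<close>

lemma normal_derivative_tangent:
  assumes "(outward_unit_normal B S has_derivative L) (at (\<phi> x0) within S)"
  shows "L (f' x0 h) = D h"
proof -
  obtain G where G: "bounded_linear G" "\<And>h. G (f' x0 h) = h"
    using chart_left_inverse[OF x0] by blast
  obtain \<epsilon> where \<epsilon>: "\<epsilon> > 0" "\<And>t. t \<in> {-\<epsilon><..<\<epsilon>} \<Longrightarrow> \<phi> (x0 + t *\<^sub>R h) \<in> S \<and> (\<lambda>t. \<phi> (x0 + t *\<^sub>R h)) differentiable (at t)"
    "((\<lambda>t. \<phi> (x0 + t *\<^sub>R h)) has_vector_derivative f' x0 h) (at 0)"
    using chart_curve[OF x0, of h] by blast
  have "((\<lambda>t. outward_unit_normal B S (\<phi> (x0 + t *\<^sub>R h))) has_vector_derivative L' (f' x0 h)) (at 0)"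
    if "(outward_unit_normal B S has_derivative L') (at (\<phi> x0) within S)" for L'
    using \<epsilon> by (intro curve_derivative[of \<epsilon> _ "\<phi> x0", OF _ _ _ _ that]) auto
  from vector_derivative_unique_at[OF this[OF assms] this[OF normal_has_derivative[OF G]]]
  show ?thesis by (simp add: G)
qed

lemma principal_curvatures_chart:
  "principal_curvatures B S (\<phi> x0) = {\<kappa>. \<exists>h. h \<noteq> 0 \<and> D h = \<kappa> *\<^sub>R f' x0 h}"
proof (intro equalityI subsetI)
  fix \<kappa> assume "\<kappa> \<in> principal_curvatures B S (\<phi> x0)"
  then obtain L h where "(outward_unit_normal B S has_derivative L) (at (\<phi> x0) within S)"
    "f' x0 h \<noteq> 0" "L (f' x0 h) = \<kappa> *\<^sub>R f' x0 h"
    unfolding principal_curvatures_def tangent_plane_chart[OF x0] by blast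
  then have "h \<noteq> 0 \<and> D h = \<kappa> *\<^sub>R f' x0 h"
    using normal_derivative_tangent by (auto simp: blinfun.zero_right)
  then show "\<kappa> \<in> {\<kappa>. \<exists>h. h \<noteq> 0 \<and> D h = \<kappa> *\<^sub>R f' x0 h}" by blast
next
  fix \<kappa> assume "\<kappa> \<in> {\<kappa>. \<exists>h. h \<noteq> 0 \<and> D h = \<kappa> *\<^sub>R f' x0 h}"
  then obtain h where h: "h \<noteq> 0" "D h = \<kappa> *\<^sub>R f' x0 h" by blast
  obtain G where G: "bounded_linear G" "\<And>h. G (f' x0 h) = h"
    using chart_left_inverse[OF x0] by blast
  have "f' x0 h \<noteq> 0"
    using h(1) injD[OF inj[OF x0], of h 0] by (auto simp: blinfun.zero_right)
  then show "\<kappa> \<in> principal_curvatures B S (\<phi> x0)"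
    unfolding principal_curvatures_def tangent_plane_chart[OF x0]
    using normal_has_derivative[OF G] h(2) G(2)
    by (intro CollectI exI[of _ "\<lambda>v. D (G v)"] conjI bexI[of _ "f' x0 h"]) auto
qed

lemma finite_principal_curvatures: "finite (principal_curvatures B S (\<phi> x0))"
proof -
  obtain G where G: "bounded_linear G" "\<And>h. G (f' x0 h) = h"
    using chart_left_inverse[OF x0] by blast
  have "linear (\<lambda>h. G (D h))"
    using bounded_linear_compose[OF G(1) has_strict_derivative_imp_bounded_linear[OF D]]
    by (rule bounded_linear.linear)
  then have "finite {\<kappa>. \<exists>h. h \<noteq> 0 \<and> G (D h) = \<kappa> *\<^sub>R h}"
    by (rule finite_real_eigenvalues)
  moreover have "principal_curvatures B S (\<phi> x0) \<subseteq> {\<kappa>. \<exists>h. h \<noteq> 0 \<and> G (D h) = \<kappa> *\<^sub>R h}"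
    unfolding principal_curvatures_chart
    using G(2) linear_scale[OF bounded_linear.linear[OF G(1)]] by fastforce
  ultimately show ?thesis by (rule finite_subset[rotated])
qed

text \<open>Dividing \<open>supports_monotone\<close> by \<open>t^2\<close> along a chart curve and
  letting \<open>t\<close> tend to 0 gives \<open>f' x0 h \<bullet> f' x0 h \<le> 2 * w * (D h
  \<bullet> f' x0 h)\<close>. For a principal direction the right side is
  \<open>2 * w * \<kappa>\<close> times the left.\<close>

lemma principal_curvature_ge:
  assumes "\<kappa> \<in> principal_curvatures B S (\<phi> x0)"
  shows "1 / (2 * w) \<le> \<kappa>"
proof -
  obtain h where h: "h \<noteq> 0" "D h = \<kappa> *\<^sub>R f' x0 h"
    using assms unfolding principal_curvatures_chart by blast
  define X where "X t = (1 / t) *\<^sub>R (\<phi> (x0 + t *\<^sub>R h) - \<phi> x0)" for t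
  define Y where "Y t = (1 / t) *\<^sub>R (N (x0 + t *\<^sub>R h) - N x0)" for t
  have X: "(X \<longlongrightarrow> f' x0 h) (at 0)"
    unfolding X_def by (rule directional_derivative_tendsto[OF \<phi>'[OF x0]])
  have Y: "(Y \<longlongrightarrow> D h) (at 0)"
    unfolding Y_def
    by (rule directional_derivative_tendsto[OF has_strict_derivative_imp_has_derivative[OF D]])
  have "\<forall>\<^sub>F t in at 0. 0 \<le> 2 * w * (Y t \<bullet> X t) - X t \<bullet> X t"
  proof -
    have "((\<lambda>t. x0 + t *\<^sub>R h) \<longlongrightarrow> x0 + 0 *\<^sub>R h) (at 0)"
      by (intro tendsto_intros)
    then have "\<forall>\<^sub>F t in at 0. x0 + t *\<^sub>R h \<in> U"
      using U x0 by (intro topological_tendstoD[where S = U]) auto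
    then show ?thesis
    proof (rule eventually_mono)
      fix t assume t: "x0 + t *\<^sub>R h \<in> U"
      have "(norm (\<phi> (x0 + t *\<^sub>R h) - \<phi> x0))\<^sup>2 \<le> 2 * w * ((N (x0 + t *\<^sub>R h) - N x0) \<bullet> (\<phi> (x0 + t *\<^sub>R h) - \<phi> x0))"
        by (rule supports_monotone) (use outward_unit_normal_supports t x0 in auto)
      then have "(1 / t)\<^sup>2 * (norm (\<phi> (x0 + t *\<^sub>R h) - \<phi> x0))\<^sup>2 \<le> (1 / t)\<^sup>2 * (2 * w * ((N (x0 + t *\<^sub>R h) - N x0) \<bullet> (\<phi> (x0 + t *\<^sub>R h) - \<phi> x0)))"
        by (intro mult_left_mono) auto
      then show "0 \<le> 2 * w * (Y t \<bullet> X t) - X t \<bullet> X t"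
        unfolding power2_norm_eq_inner by (simp add: X_def Y_def power2_eq_square)
    qed
  qed
  moreover have "((\<lambda>t. 2 * w * (Y t \<bullet> X t) - X t \<bullet> X t) \<longlongrightarrow> 2 * w * (D h \<bullet> f' x0 h) - f' x0 h \<bullet> f' x0 h) (at 0)"
    by (intro tendsto_intros X Y)
  ultimately have "0 \<le> 2 * w * (D h \<bullet> f' x0 h) - f' x0 h \<bullet> f' x0 h"
    by (intro tendsto_lowerbound) auto
  then have "0 \<le> (2 * w * \<kappa> - 1) * (f' x0 h \<bullet> f' x0 h)"
    by (simp add: h(2) algebra_simps)
  moreover have "f' x0 h \<bullet> f' x0 h > 0"
    using h(1) injD[OF inj[OF x0], of h 0] by (auto simp: blinfun.zero_right)
  ultimately have "0 \<le> 2 * w * \<kappa> - 1"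
    by (simp add: zero_le_mult_iff)
  then show ?thesis using w_pos by (simp add: field_simps)
qed

text \<open>The map \<open>F\<close> parametrises the opposite patch. A nonzero kernel vector of its
  derivative would be a principal direction with curvature \<open>1 / (2 * w)\<close>, so
  \<open>F\<close> as well as \<open>\<phi>\<close> has an inverse Lipschitz bound. With the
  Lipschitz bound for \<open>N\<close>, these give the two local estimates behind the interior
  balls.\<close>

lemma perturbable_of_curvature_gap:
  assumes "1 / (2 * w) \<notin> principal_curvatures B S (\<phi> x0)"
  shows "\<exists>c0 c r. perturbable_body B w (N x0) c0 c r \<and> c < 1"
proof -
  define F where "F x = \<phi> x - (2 * w) *\<^sub>R N x" for x
  define F' where "F' h = f' x0 h - (2 * w) *\<^sub>R D h" for h
  have F: "has_strict_derivative F F' x0"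
    unfolding F_def F'_def by (rule has_strict_derivative_diff_scaleR[OF strict_chart[OF x0] D])
  have linF': "linear F'"
    using has_strict_derivative_imp_bounded_linear[OF F] by (rule bounded_linear.linear)
  have "inj F'"
    unfolding linear_injective_0[OF linF']
  proof (intro allI impI, rule ccontr)
    fix h assume "F' h = 0" "h \<noteq> 0"
    then have "(1 / (2 * w)) *\<^sub>R f' x0 h = (1 / (2 * w)) *\<^sub>R (2 * w) *\<^sub>R D h"
      by (simp add: F'_def)
    then have "D h = (1 / (2 * w)) *\<^sub>R f' x0 h" using w_pos by simp
    then show False
      using assms \<open>h \<noteq> 0\<close> unfolding principal_curvatures_chart by blast
  qed
  obtain d1 m1 where m1: "d1 > 0" "m1 > 0" "\<And>x y. x \<in> ball x0 d1 \<Longrightarrow> y \<in> ball x0 d1 \<Longrightarrow> m1 * norm (x - y) \<le> norm (\<phi> x - \<phi> y)"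
    using has_strict_derivative_inj_bound[OF strict_chart[OF x0] inj[OF x0]] by blast
  obtain d2 m2 where m2: "d2 > 0" "m2 > 0" "\<And>x y. x \<in> ball x0 d2 \<Longrightarrow> y \<in> ball x0 d2 \<Longrightarrow> m2 * norm (x - y) \<le> norm (F x - F y)"
    using has_strict_derivative_inj_bound[OF F \<open>inj F'\<close>] by blast
  obtain d3 M where M: "d3 > 0" "M > 0" "\<And>x y. x \<in> ball x0 d3 \<Longrightarrow> y \<in> ball x0 d3 \<Longrightarrow> norm (N x - N y) \<le> M * norm (x - y)"
    using has_strict_derivative_lipschitz[OF D] by blast
  define d where "d = min d1 (min d2 d3)"
  have "d > 0" using m1 m2 M by (simp add: d_def)
  obtain \<delta> where \<delta>: "\<delta> > 0" "\<And>y. y \<in> frontier B \<Longrightarrow> norm (y - \<phi> x0) < \<delta> \<Longrightarrow> y \<in> S \<and> \<psi> y \<in> U \<and> \<psi> y \<in> ball x0 d \<and> \<phi> (\<psi> y) = y"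
    using frontier_near_chart[OF x0 \<open>d > 0\<close>] by blast
  define C where "C = max (M / m1) (M / m2)"
  \<comment> \<open>A support point of a body lies on its boundary, and its unit normal at a chart
    point is unique; so any support pair close to \<open>\<phi> x0\<close> comes from a
    parameter.\<close>
  have near: "\<exists>q\<in>ball x0 d. y = \<phi> q \<and> u = N q" if "norm u = 1" "supports B u y" "norm (y - \<phi> x0) < \<delta>" for u y
  proof -
    have "y \<notin> interior B"
    proof
      assume "y \<in> interior B"
      then obtain e where e: "e > 0" "cball y e \<subseteq> B" by (auto simp: mem_interior_cball)
      then have "y + e *\<^sub>R u \<in> B" using that(1) by (intro subsetD[OF e(2)]) (simp add: dist_norm)
      then have "u \<bullet> (y + e *\<^sub>R u) \<le> u \<bullet> y"
        using inner_le_support_fun[OF compact_body] that(2) by (simp add: supports_def)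
      then show False using that(1) e(1) by (simp add: inner_add_right norm_eq_1)
    qed
    then have "y \<in> frontier B"
      using that(2) closure_subset by (auto simp: frontier_def supports_def)
    then have "\<psi> y \<in> U" "\<psi> y \<in> ball x0 d" "\<phi> (\<psi> y) = y"
      using \<delta>(2) that(3) by auto
    then show ?thesis
      using outward_unit_normal_eq[of "\<psi> y" u] that by (intro bexI[of _ "\<psi> y"]) auto
  qed
  have loc: "norm (u - v) \<le> C * norm (x - y) \<and> norm (u - v) \<le> C * norm ((x - y) - (2 * w) *\<^sub>R (u - v))"
    if u: "norm u = 1" "supports B u x" "norm (x - \<phi> x0) < \<delta>" and v: "norm v = 1" "supports B v y" "norm (y - \<phi> x0) < \<delta>"
    for u v x y
  proof -
    obtain q1 q2 where q: "q1 \<in> ball x0 d" "x = \<phi> q1" "u = N q1" "q2 \<in> ball x0 d" "y = \<phi> q2" "v = N q2"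
      using near[OF u] near[OF v] by blast
    have q': "q1 \<in> ball x0 d1" "q2 \<in> ball x0 d1" "q1 \<in> ball x0 d2" "q2 \<in> ball x0 d2" "q1 \<in> ball x0 d3" "q2 \<in> ball x0 d3"
      using q(1,4) by (auto simp: d_def)
    have "norm (u - v) \<le> M * norm (q1 - q2)"
      unfolding q(3,6) by (rule M(3)[OF q'(5,6)])
    moreover have "M * norm (q1 - q2) \<le> M / m1 * norm (x - y)"
      using m1(2) M(2) m1(3)[OF q'(1,2)] q by (simp add: field_simps)
    moreover have "M / m1 * norm (x - y) \<le> C * norm (x - y)"
      by (intro mult_right_mono) (auto simp: C_def)
    moreover have Fq: "F q1 - F q2 = (x - y) - (2 * w) *\<^sub>R (u - v)"
      unfolding F_def q by (simp add: algebra_simps)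
    moreover have "M * norm (q1 - q2) \<le> M / m2 * norm (F q1 - F q2)"
      using m2(2) M(2) m2(3)[OF q'(3,4)] by (simp add: field_simps)
    moreover have "M / m2 * norm (F q1 - F q2) \<le> C * norm (F q1 - F q2)"
      by (intro mult_right_mono) (auto simp: C_def)
    ultimately show ?thesis by simp
  qed
  have N0: "norm (N x0) = 1" "supports B (N x0) (\<phi> x0)"
    using outward_unit_normal_supports[OF x0] by auto
  obtain \<eta> K where "\<eta> > 0" "K > 0"
    "\<And>u x v y. norm u = 1 \<Longrightarrow> supports B u x \<Longrightarrow> norm (u - N x0) < \<eta> \<Longrightarrow> norm v = 1 \<Longrightarrow> supports B v y \<Longrightarrow>
      norm (u - v) \<le> K * norm (x - y) \<and> norm (u - v) \<le> K * norm ((x - y) - (2 * w) *\<^sub>R (u - v))"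
    using normal_difference_le[OF N0 \<delta>(1), of C] loc by blast
  then show ?thesis
    by (intro perturbable_of_normal_difference_le[OF N0(1)])
qed

end

end

theorem mainTheorem1:
  fixes B S :: "(real^3) set" and w :: real
  assumes "w > 0"
    and "convex_body B"
    and "has_constant_width B (2 * w)"
    and "local_minimizer w B"
    and "smooth_part B S"
  shows "\<forall>p\<in>S. smaller_principal_curvature B S p = 1 / (2 * w)"
proof
  fix p assume p: "p \<in> S"
  obtain V U \<phi> \<psi> where ch: "open V" "p \<in> V" "open U" "C2_on \<phi> U"
      "\<forall>x\<in>U. inj (frechet_derivative \<phi> (at x))" "homeomorphism U (S \<inter> V) \<phi> (\<psi> :: real^3 \<Rightarrow> real^2)"
    using assms(5) p unfolding smooth_part_def embedded_C2_surface_def by meson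
  obtain f' f'' where f: "\<And>x. x \<in> U \<Longrightarrow> (\<phi> has_derivative blinfun_apply (f' x)) (at x)"
    "\<And>x. x \<in> U \<Longrightarrow> (f' has_derivative blinfun_apply (f'' x)) (at x)" "continuous_on U f''"
    using ch(4) unfolding C2_on_def by blast
  interpret boundary_chart B w S V U \<phi> \<psi> f' f''
  proof unfold_locales
    show "openin (top_of_set (frontier B)) S" using assms(5) by (simp add: smooth_part_def)
    show "inj (f' x)" if "x \<in> U" for x
      using ch(5) frechet_derivative_at[OF f(1)[OF that]] that by simp
  qed (use assms ch f in auto)
  define x0 where "x0 = \<psi> p"
  have x0: "x0 \<in> U" "\<phi> x0 = p"
    using ch(2,6) p by (auto simp: x0_def homeomorphism_def)
  obtain D where D: "has_strict_derivative N D x0"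
    using strict_normal[OF x0(1)] by blast
  have "1 / (2 * w) \<in> principal_curvatures B S p"
    using perturbable_of_curvature_gap[OF x0(1) D] perturbable_not_local_minimizer assms(4)
    unfolding x0(2) by blast
  \<comment> \<open>\<open>Min\<close> is meaningful only for a finite set; with finiteness and the
    lower bound, membership of \<open>1 / (2 * w)\<close> identifies the minimum.\<close>
  then show "smaller_principal_curvature B S p = 1 / (2 * w)"
    unfolding smaller_principal_curvature_def
    using finite_principal_curvatures[OF x0(1) D] principal_curvature_ge[OF x0(1) D] x0(2)
    by (intro Min_eqI) auto
qed

end
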